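(* Let $t\ge 2$ and $r$ be integers and let $H$ be a graph with chromatic number $\chi(H)=r+1>t$. For every $\epsilon>0$ there exist $\delta>0$ and $n_0$ such that if $G$ is an $H$-free graph on $n\geq n_0$ vertices and $$\rho_{t}(G)\geq\left(\binom{r-1}{t-1}\left(\frac{1}{r}\right)^{t-1}-\delta\right)n^{t-1},$$ then $G$ can be obtained from the Turán graph $T_{r}(n)$ by adding and deleting at most $\epsilon n^{2}$ edges.
   Context: All graphs are finite and simple. A graph $G$ is $H$-free if it contains no subgraph isomorphic to $H$. $T_r(n)$ is the Turán graph: the complete $r$-partite graph on $n$ vertices with part sizes as equal as possible. A $t$-clique is a set of $t$ vertices inducing a complete subgraph; $C_t(G)$ denotes the set of $t$-cliques of $G$. For an $n$-vertex graph $G$ with vertex set $\{1,\dots,n\}$, the $t$-clique tensor $\mathcal{A}(G)=(a_{i_1\cdots i_t})$ is the order $t$, dimension $n$ tensor with $a_{i_1\cdots i_t}=\frac{1}{(t-1)!}$ if $\{i_1,\dots,i_t\}\in C_t(G)$ and $0$ otherwise. A complex number $\lambda$ is an eigenvalue of an order $m$ dimension $n$ tensor $\mathcal{A}=(a_{i_1\cdots i_m})$ if there is a nonzero complex vector $x$ with $\lambda x_i^{m-1}=\sum_{i_2,\dots,i_m=1}^n a_{i i_2\cdots i_m}x_{i_2}\cdots x_{i_m}$ for all $i$. The $t$-clique spectral radius $\rho_t(G)$ is the maximum modulus of the eigenvalues of $\mathcal{A}(G)$. *)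

theory Defs
  imports Complex_Main
begin

section \<open>Finite simple graphs\<close>

record 'a graph =
  verts :: "'a set"
  edges :: "'a set set"

definition simple_graph :: "'a graph \<Rightarrow> bool" where
  "simple_graph G \<longleftrightarrow> finite (verts G) \<and> (\<forall>e\<in>edges G. e \<subseteq> verts G \<and> card e = 2)"

definition subgraph_of :: "'a graph \<Rightarrow> 'a graph \<Rightarrow> bool" where
  "subgraph_of K G \<longleftrightarrow> simple_graph K \<and> verts K \<subseteq> verts G \<and> edges K \<subseteq> edges G"

definition isomorphic :: "'a graph \<Rightarrow> 'b graph \<Rightarrow> bool" where
  "isomorphic H K \<longleftrightarrow>
     (\<exists>f. bij_betw f (verts H) (verts K) \<and>
          (\<forall>u\<in>verts H. \<forall>v\<in>verts H. {u, v} \<in> edges H \<longleftrightarrow> {f u, f v} \<in> edges K))"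

definition H_free :: "'a graph \<Rightarrow> 'b graph \<Rightarrow> bool" where
  "H_free H G \<longleftrightarrow> \<not> (\<exists>K. subgraph_of K G \<and> isomorphic H K)"

definition proper_coloring :: "'a graph \<Rightarrow> nat \<Rightarrow> ('a \<Rightarrow> nat) \<Rightarrow> bool" where
  "proper_coloring G k c \<longleftrightarrow>
     (\<forall>v\<in>verts G. c v < k) \<and>
     (\<forall>u\<in>verts G. \<forall>v\<in>verts G. {u, v} \<in> edges G \<longrightarrow> c u \<noteq> c v)"

definition chromatic_number :: "'a graph \<Rightarrow> nat" where
  "chromatic_number G = (LEAST k. \<exists>c. proper_coloring G k c)"

text \<open>The Turan graph is only determined up to isomorphism, so it is given as a predicate:
  \<open>p\<close> assigns to each vertex the index of its part (parts are empty when there are fewer than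
  \<open>r\<close> vertices).\<close>

definition is_turan_graph :: "nat \<Rightarrow> nat \<Rightarrow> 'a graph \<Rightarrow> bool" where
  "is_turan_graph r n T \<longleftrightarrow>
     finite (verts T) \<and> card (verts T) = n \<and>
     (\<exists>p :: 'a \<Rightarrow> nat.
        (\<forall>v\<in>verts T. p v < r) \<and>
        edges T = {{u, v} | u v. u \<in> verts T \<and> v \<in> verts T \<and> p u \<noteq> p v} \<and>
        (\<forall>i<r. \<forall>j<r. card {v \<in> verts T. p v = i} \<le> card {v \<in> verts T. p v = j} + 1))"

definition cliques :: "nat \<Rightarrow> 'a graph \<Rightarrow> 'a set set" where
  "cliques t G =
     {S. S \<subseteq> verts G \<and> finite S \<and> card S = t \<and> (\<forall>u\<in>S. \<forall>v\<in>S. u \<noteq> v \<longrightarrow> {u, v} \<in> edges G)}"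

section \<open>Tensors and the clique spectral radius\<close>

text \<open>A tensor of order \<open>m\<close> and dimension \<open>n\<close> is a function on index lists of length \<open>m\<close> with
  entries in \<open>{1..n}\<close>; its values on other lists, and those of a vector outside \<open>{1..n}\<close>, are
  irrelevant.\<close>

definition tensor_eigenvalue :: "nat \<Rightarrow> nat \<Rightarrow> (nat list \<Rightarrow> complex) \<Rightarrow> complex \<Rightarrow> bool" where
  "tensor_eigenvalue m n A \<mu> \<longleftrightarrow>
     (\<exists>x :: nat \<Rightarrow> complex.
        (\<exists>i\<in>{1..n}. x i \<noteq> 0) \<and>
        (\<forall>i\<in>{1..n}. \<mu> * x i ^ (m - 1) =
           (\<Sum>js | length js = m - 1 \<and> set js \<subseteq> {1..n}. A (i # js) * (\<Prod>j\<leftarrow>js. x j))))"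

definition clique_tensor :: "nat \<Rightarrow> nat graph \<Rightarrow> nat list \<Rightarrow> complex" where
  "clique_tensor t G js = (if set js \<in> cliques t G then 1 / fact (t - 1) else 0)"

text \<open>For a graph with vertex set \<open>{1..n}\<close>. The maximum is taken with \<open>Greatest\<close> and not \<open>Max\<close>,
  because \<open>Max\<close> is meaningful only once the set of eigenvalues is known to be finite.\<close>

definition clique_spectral_radius :: "nat \<Rightarrow> nat graph \<Rightarrow> real" where
  "clique_spectral_radius t G =
     (GREATEST \<rho>. \<exists>\<mu>. tensor_eigenvalue t (card (verts G)) (clique_tensor t G) \<mu> \<and> \<rho> = cmod \<mu>)"

end

theory Submission
  imports Defs "HOL-Analysis.Analysis" "HOL-Combinatorics.Multiset_Permutations"
    "Jordan_Normal_Form.Spectral_Radius"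
begin

text \<open>
  Let \<open>y\<close> be the entrywise modulus of an eigenvector for the spectral radius, scaled to maximum 1.
  The eigenvalue equations bound \<open>\<rho> * (\<Sum>v. y v ^ t)\<close> by \<open>t\<close> times the number of \<open>t\<close>-cliques weighted
  by \<open>y\<close>. An \<open>H\<close>-free graph has only \<open>o(n ^ (r + 1))\<close> cliques of size \<open>r + 1\<close>, and the weighted
  Moon--Moser inequalities then bound the weighted clique count by its value in the Turan graph. So
  the power mean inequality between the first and the \<open>t\<close>-th moment of \<open>y\<close> is almost tight, \<open>y\<close> is
  almost constant, and the unweighted number of \<open>t\<close>-cliques is almost extremal. Equality in the
  Moon--Moser inequalities propagates to all clique sizes up to \<open>r\<close>. Finally, a typical \<open>r\<close>-clique
  \<open>K\<close> yields the partition: the common neighbourhoods of the sets \<open>K - {x}\<close> are almost disjoint, cover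
  almost everything, and span few edges. No regularity lemma is needed.
\<close>

section \<open>Weighted clique counts and the Moon--Moser inequalities\<close>

text \<open>Nothing says in advance that the eigenvector is nearly constant, so stability is applied
  twice: first to the densities weighted by \<open>y\<close>, where it is used only for an upper
  bound on the weighted \<open>t\<close>-clique count, and then, once \<open>y\<close> is known to
  be flat, to the unweighted densities. Scaling the maximum of \<open>y\<close> to 1 pays twice:
  weighted counts are at most plain counts, and the equation at a maximal coordinate bounds
  \<open>\<rho>\<close> by \<open>(sum y) ^ (t - 1)\<close>. The mean of \<open>y\<close> is thus
  bounded below, and dividing by powers of \<open>sum y\<close> instead of \<open>n\<close> costs
  only a constant factor. Stability of the densities is proved by compactness: in the limit the
  density of \<open>(r + 1)\<close>-cliques is exactly 0, so only an exact equality case has to be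
  analysed. Cliques of size \<open>r + 1\<close> are rare because a positive density of them would
  contain a complete \<open>(r + 1)\<close>-partite configuration with parts as large as the vertex
  set of \<open>H\<close>, into which a proper colouring embeds \<open>H\<close>.\<close>

definition common_nbrs :: "'a graph \<Rightarrow> 'a set \<Rightarrow> 'a set" where
  "common_nbrs G J = {v \<in> verts G. \<forall>u\<in>J. {u, v} \<in> edges G}"

definition clique_weight :: "'a graph \<Rightarrow> ('a \<Rightarrow> real) \<Rightarrow> nat \<Rightarrow> real" where
  "clique_weight G w s = (\<Sum>S\<in>cliques s G. \<Prod>v\<in>S. w v)"

definition codegree :: "'a graph \<Rightarrow> ('a \<Rightarrow> real) \<Rightarrow> 'a set \<Rightarrow> real" where
  "codegree G w J = (\<Sum>v\<in>common_nbrs G J. w v)"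

lemma finite_common_nbrs: "simple_graph G \<Longrightarrow> finite (common_nbrs G J)"
  by (auto simp: common_nbrs_def simple_graph_def)

lemma common_nbrs_disjoint: "simple_graph G \<Longrightarrow> v \<in> common_nbrs G J \<Longrightarrow> v \<notin> J"
  by (fastforce simp: common_nbrs_def simple_graph_def)

lemma finite_cliques: "simple_graph G \<Longrightarrow> finite (cliques s G)"
  by (rule finite_subset[of _ "Pow (verts G)"]) (auto simp: cliques_def simple_graph_def)

lemma cliquesD:
  assumes "S \<in> cliques s G"
  shows "S \<subseteq> verts G" "finite S" "card S = s"
    "\<And>u v. u \<in> S \<Longrightarrow> v \<in> S \<Longrightarrow> u \<noteq> v \<Longrightarrow> {u, v} \<in> edges G"
  using assms by (auto simp: cliques_def)

lemma cliques_0: "cliques 0 G = {{}}"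
  by (auto simp: cliques_def)

lemma cliques_1: "cliques (Suc 0) G = (\<lambda>v. {v}) ` verts G"
  by (auto simp: cliques_def card_Suc_eq)

lemma clique_remove:
  assumes "K \<in> cliques (Suc s) G" "x \<in> K"
  shows "K - {x} \<in> cliques s G" "x \<in> common_nbrs G (K - {x})"
  using assms by (auto simp: cliques_def common_nbrs_def)

lemma clique_insert:
  assumes "simple_graph G" "J \<in> cliques s G" "x \<in> common_nbrs G J"
  shows "insert x J \<in> cliques (Suc s) G"
  using assms common_nbrs_disjoint[OF assms(1,3)]
  by (auto simp: cliques_def common_nbrs_def insert_commute)

text \<open>Double counting used throughout: an \<open>(s + 1)\<close>-clique with a marked vertex
  \<open>x\<close> is the same data as an \<open>s\<close>-clique \<open>K - {x}\<close> with a
  common neighbour \<open>x\<close>. Since \<open>f\<close> depends on the whole pair, the identity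
  serves weights, codegrees and counts of edges in neighbourhoods alike.\<close>

lemma sum_clique_remove:
  assumes "simple_graph G"
  shows "(\<Sum>K\<in>cliques (Suc s) G. \<Sum>x\<in>K. f (K - {x}) x) =
    (\<Sum>J\<in>cliques s G. \<Sum>x\<in>common_nbrs G J. f J x)"
proof -
  have "(\<Sum>K\<in>cliques (Suc s) G. \<Sum>x\<in>K. f (K - {x}) x) =
     (\<Sum>(K, x)\<in>Sigma (cliques (Suc s) G) (\<lambda>K. K). f (K - {x}) x)"
    by (rule sum.Sigma) (auto simp: finite_cliques assms dest: cliquesD)
  also have "\<dots> = (\<Sum>(J, x)\<in>Sigma (cliques s G) (common_nbrs G). f J x)"
    by (rule sum.reindex_bij_witness[where j = "\<lambda>(K, x). (K - {x}, x)" and i = "\<lambda>(J, x). (insert x J, x)"])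
      (auto simp: clique_remove clique_insert[OF assms] dest: common_nbrs_disjoint[OF assms])
  also have "\<dots> = (\<Sum>J\<in>cliques s G. \<Sum>x\<in>common_nbrs G J. f J x)"
    by (rule sum.Sigma[symmetric]) (auto simp: finite_cliques finite_common_nbrs assms)
  finally show ?thesis .
qed

lemma clique_weight_0: "clique_weight G w 0 = 1"
  by (simp add: clique_weight_def cliques_0)

lemma clique_weight_1: "clique_weight G w (Suc 0) = sum w (verts G)"
  by (simp add: clique_weight_def cliques_1 sum.reindex)

lemma clique_weight_nonneg: "(\<And>v. w v \<ge> 0) \<Longrightarrow> clique_weight G w s \<ge> 0"
  by (simp add: clique_weight_def sum_nonneg prod_nonneg)

text \<open>An \<open>(s + 1)\<close>-clique arises once for each choice of its marked vertex, hence
  the factor \<open>Suc s\<close>.\<close>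

lemma sum_codegree_clique:
  assumes "simple_graph G"
  shows "(\<Sum>J\<in>cliques s G. (\<Prod>v\<in>J. w v) * codegree G w J) = real (Suc s) * clique_weight G w (Suc s)"
proof -
  have "(\<Sum>J\<in>cliques s G. (\<Prod>v\<in>J. w v) * codegree G w J) =
      (\<Sum>J\<in>cliques s G. \<Sum>x\<in>common_nbrs G J. (\<Prod>v\<in>J. w v) * w x)"
    by (simp add: codegree_def sum_distrib_left)
  also have "\<dots> = (\<Sum>K\<in>cliques (Suc s) G. \<Sum>x\<in>K. (\<Prod>v\<in>K - {x}. w v) * w x)"
    by (rule sum_clique_remove[OF assms, symmetric])
  also have "\<dots> = (\<Sum>K\<in>cliques (Suc s) G. \<Sum>x\<in>K. \<Prod>v\<in>K. w v)"
    by (intro sum.cong refl) (simp add: cliquesD prod.remove mult.commute)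
  also have "\<dots> = real (Suc s) * clique_weight G w (Suc s)"
    by (simp add: clique_weight_def cliquesD sum_distrib_left)
  finally show ?thesis .
qed

text \<open>A vertex counted for two different \<open>x\<close> is adjacent to all of \<open>K\<close>.\<close>

lemma card_almost_common_nbrs:
  assumes "K \<in> cliques (Suc s) G" "v \<in> verts G"
  shows "real (card {x \<in> K. v \<in> common_nbrs G (K - {x})}) \<le>
    (if \<exists>x\<in>K. v \<in> common_nbrs G (K - {x}) then 1 else 0) + real s * (if v \<in> common_nbrs G K then 1 else 0)"
proof (cases "v \<in> common_nbrs G K")
  case True
  have "card {x \<in> K. v \<in> common_nbrs G (K - {x})} \<le> Suc s"
    using card_mono[of K "{x \<in> K. v \<in> common_nbrs G (K - {x})}"] cliquesD[OF assms(1)] by auto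
  moreover have "\<exists>x\<in>K. v \<in> common_nbrs G (K - {x})"
    using True cliquesD(3)[OF assms(1)] by (fastforce simp: common_nbrs_def card_Suc_eq)
  ultimately show ?thesis using True by auto
next
  case False
  have "x = x'" if "x \<in> K" "x' \<in> K" "v \<in> common_nbrs G (K - {x})" "v \<in> common_nbrs G (K - {x'})" for x x'
    using that False by (auto simp: common_nbrs_def)
  then have "card {x \<in> K. v \<in> common_nbrs G (K - {x})} \<le> 1"
    using cliquesD(2)[OF assms(1)] by (auto simp: card_le_Suc0_iff_eq)
  moreover have "card {x \<in> K. v \<in> common_nbrs G (K - {x})} = 0" if "\<not> (\<exists>x\<in>K. v \<in> common_nbrs G (K - {x}))"
    using that by (intro card_eq_0_iff[THEN iffD2]) auto
  ultimately show ?thesis using False by auto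
qed

text \<open>The previous pointwise bound, summed over \<open>v\<close> with weight
  \<open>w v\<close>. The union is kept on the right, not yet bounded by all vertices, because the
  choice of a good clique later depends on how many vertices this union misses.\<close>

lemma sum_codegree_remove:
  assumes "simple_graph G" "K \<in> cliques (Suc s) G" and w: "\<And>v. w v \<ge> 0"
  shows "(\<Sum>x\<in>K. codegree G w (K - {x})) \<le>
    sum w (\<Union>x\<in>K. common_nbrs G (K - {x})) + real s * codegree G w K"
proof -
  let ?N = "\<lambda>x. common_nbrs G (K - {x})"
  have fin: "finite (verts G)" "finite K" using assms(1,2) by (auto simp: simple_graph_def dest: cliquesD)
  have ind: "sum w A = (\<Sum>v\<in>verts G. w v * (if v \<in> A then 1 else 0))" if "A \<subseteq> verts G" for A
  proof -
    have "(\<Sum>v\<in>verts G. w v * (if v \<in> A then 1 else 0)) = (\<Sum>v\<in>verts G. if v \<in> A then w v else 0)"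
      by (intro sum.cong) auto
    also have "\<dots> = sum w (verts G \<inter> A)" using fin by (simp add: sum.If_cases)
    finally show ?thesis using that by (simp add: inf_absorb2)
  qed
  have sub: "common_nbrs G J \<subseteq> verts G" for J by (auto simp: common_nbrs_def)
  have "(\<Sum>x\<in>K. codegree G w (K - {x})) = (\<Sum>x\<in>K. \<Sum>v\<in>verts G. w v * (if v \<in> ?N x then 1 else 0))"
    by (simp only: codegree_def ind[OF sub])
  also have "\<dots> = (\<Sum>v\<in>verts G. \<Sum>x\<in>K. w v * (if v \<in> ?N x then 1 else 0))"
    by (rule sum.swap)
  also have "\<dots> = (\<Sum>v\<in>verts G. w v * real (card {x \<in> K. v \<in> ?N x}))"
    using fin by (simp add: sum_distrib_left[symmetric] sum.If_cases Int_def)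
  also have "\<dots> \<le> (\<Sum>v\<in>verts G. w v * ((if v \<in> (\<Union>x\<in>K. ?N x) then 1 else 0) + real s * (if v \<in> common_nbrs G K then 1 else 0)))"
    using card_almost_common_nbrs[OF assms(2)] by (intro sum_mono mult_left_mono w) auto
  also have "\<dots> = sum w (\<Union>x\<in>K. ?N x) + real s * codegree G w K"
    unfolding codegree_def ind[OF sub] using ind[of "\<Union>x\<in>K. ?N x"] sub
    by (simp add: distrib_left sum.distrib sum_distrib_left mult_ac UN_least)
  finally show ?thesis .
qed

text \<open>Cauchy--Schwarz with respect to the clique weights as a measure, which is why each
  weight is split into two square roots. Marking a vertex then turns the sum of squared codegrees
  over \<open>s\<close>-cliques into a sum over \<open>(s + 1)\<close>-cliques.\<close>

lemma sum_codegree_squares: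
  assumes "simple_graph G" and w: "\<And>v. w v \<ge> 0"
  shows "(real (Suc s) * clique_weight G w (Suc s))\<^sup>2 \<le>
    clique_weight G w s * (\<Sum>K\<in>cliques (Suc s) G. (\<Prod>v\<in>K. w v) * (\<Sum>x\<in>K. codegree G w (K - {x})))"
proof -
  let ?p = "\<lambda>J. \<Prod>v\<in>J. w v"
  have "(\<Sum>J\<in>cliques s G. ?p J * codegree G w J)\<^sup>2 =
      (\<Sum>J\<in>cliques s G. sqrt (?p J) * (sqrt (?p J) * codegree G w J))\<^sup>2"
    by (simp add: mult.assoc[symmetric] prod_nonneg w)
  also have "\<dots> \<le> (\<Sum>J\<in>cliques s G. (sqrt (?p J))\<^sup>2) * (\<Sum>J\<in>cliques s G. (sqrt (?p J) * codegree G w J)\<^sup>2)"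
    by (rule Cauchy_Schwarz_ineq_sum)
  also have "(\<Sum>J\<in>cliques s G. (sqrt (?p J))\<^sup>2) = clique_weight G w s"
    by (simp add: clique_weight_def prod_nonneg w)
  also have "(\<Sum>J\<in>cliques s G. (sqrt (?p J) * codegree G w J)\<^sup>2) =
      (\<Sum>J\<in>cliques s G. \<Sum>x\<in>common_nbrs G J. ?p J * w x * codegree G w J)"
    by (simp add: power_mult_distrib prod_nonneg w power2_eq_square abs_of_nonneg)
      (simp add: abs_of_nonneg prod_nonneg w codegree_def sum_distrib_left sum_distrib_right mult_ac)
  also have "\<dots> = (\<Sum>K\<in>cliques (Suc s) G. \<Sum>x\<in>K. ?p (K - {x}) * w x * codegree G w (K - {x}))"
    by (rule sum_clique_remove[OF assms(1), symmetric])
  also have "\<dots> = (\<Sum>K\<in>cliques (Suc s) G. ?p K * (\<Sum>x\<in>K. codegree G w (K - {x})))"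
    unfolding sum_distrib_left
    by (intro sum.cong refl) (simp add: cliquesD prod.remove mult_ac)
  finally show ?thesis
    by (simp add: sum_codegree_clique[OF assms(1)])
qed

lemma moon_moser:
  assumes "simple_graph G" and w: "\<And>v. w v \<ge> 0"
  shows "(real (Suc s))\<^sup>2 * (clique_weight G w (Suc s))\<^sup>2 \<le>
    clique_weight G w s * (sum w (verts G) * clique_weight G w (Suc s) +
      ((real (Suc s))\<^sup>2 - 1) * clique_weight G w (Suc (Suc s)))"
proof -
  let ?p = "\<lambda>J. \<Prod>v\<in>J. w v"
  have "(\<Sum>x\<in>K. codegree G w (K - {x})) \<le> sum w (verts G) + real s * codegree G w K"
    if "K \<in> cliques (Suc s) G" for K
  proof -
    have "sum w (\<Union>x\<in>K. common_nbrs G (K - {x})) \<le> sum w (verts G)"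
      using assms by (intro sum_mono2) (auto simp: simple_graph_def common_nbrs_def)
    then show ?thesis using sum_codegree_remove[of G K s w] assms that by force
  qed
  then have "(\<Sum>K\<in>cliques (Suc s) G. ?p K * (\<Sum>x\<in>K. codegree G w (K - {x}))) \<le>
      (\<Sum>K\<in>cliques (Suc s) G. ?p K * (sum w (verts G) + real s * codegree G w K))"
    by (intro sum_mono mult_left_mono) (auto simp: prod_nonneg w)
  also have "\<dots> = sum w (verts G) * clique_weight G w (Suc s) + real s * (\<Sum>K\<in>cliques (Suc s) G. ?p K * codegree G w K)"
    by (simp add: distrib_left sum.distrib sum_distrib_left clique_weight_def mult_ac)
  \<comment> \<open>The factor \<open>s\<close> from overcounting and the factor
    \<open>s + 2\<close> from the codegree sum multiply to \<open>(s + 1)^2 - 1\<close>.\<close>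
  also have "\<dots> = sum w (verts G) * clique_weight G w (Suc s) + ((real (Suc s))\<^sup>2 - 1) * clique_weight G w (Suc (Suc s))"
    unfolding sum_codegree_clique[OF assms(1)] by (simp add: power2_eq_square algebra_simps)
  finally show ?thesis
    using mult_left_mono[OF _ clique_weight_nonneg[of w G s, OF w]] sum_codegree_squares[where s = s, OF assms]
    unfolding power_mult_distrib by (meson order_trans)
qed

section \<open>Stability of clique densities\<close>

text \<open>The limit of the number of \<open>s\<close>-cliques of the Turan graph divided by
  \<open>n ^ s\<close>: choose \<open>s\<close> of the \<open>r\<close> parts, each of relative size
  \<open>1 / r\<close>.\<close>

definition turan_density :: "nat \<Rightarrow> nat \<Rightarrow> real" where
  "turan_density r s = real (r choose s) / real r ^ s"

text \<open>The equality case of the ratio bound in \<open>clique_density_ratio\<close>; comparing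
  with it turns ratio bounds into bounds by Turan densities.\<close>

lemma turan_density_Suc:
  assumes "r > 0" "s \<le> r"
  shows "real (Suc s) * real r * turan_density r (Suc s) = (real r - real s) * turan_density r s"
proof -
  have "Suc s * (r choose Suc s) = (r - s) * (r choose s)"
    using assms(2) by (metis binomial_absorption binomial_absorb_comp)
  then have "real (Suc s) * real (r choose Suc s) = (real r - real s) * real (r choose s)"
    using assms(2) by (metis of_nat_diff of_nat_mult)
  moreover have "real (Suc s) * real r * turan_density r (Suc s) = real (Suc s) * real (r choose Suc s) / real r ^ s"
    using assms(1) by (simp add: turan_density_def)
  ultimately show ?thesis by (simp add: turan_density_def)
qed

lemma turan_density_pos: "r > 0 \<Longrightarrow> s \<le> r \<Longrightarrow> turan_density r s > 0"
  by (simp add: turan_density_def)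

lemma turan_density_0: "turan_density r 0 = 1"
  by (simp add: turan_density_def)

lemma turan_density_1: "r > 0 \<Longrightarrow> turan_density r (Suc 0) = 1"
  by (simp add: turan_density_def)

text \<open>Downward induction from the vanishing density at \<open>r + 1\<close>. Inserting the
  ratio bound for \<open>D (s + 2)\<close> into the Moon--Moser inequality leaves the factor
  \<open>r + s * (r - s - 1) = (s + 1) * (r - s)\<close>, and one power of \<open>D (s + 1)\<close>
  cancels. Stated for real sequences so that it applies to limits of densities.\<close>

lemma clique_density_ratio:
  fixes D :: "nat \<Rightarrow> real"
  assumes nn: "\<And>s. D s \<ge> 0" and last: "D (Suc r) = 0"
    and MM: "\<And>s. s < r \<Longrightarrow> (real (Suc s))\<^sup>2 * (D (Suc s))\<^sup>2 \<le>
        D s * (D (Suc s) + ((real (Suc s))\<^sup>2 - 1) * D (Suc (Suc s)))"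
    and "s \<le> r"
  shows "real (Suc s) * real r * D (Suc s) \<le> (real r - real s) * D s"
  using \<open>s \<le> r\<close>
proof (induction s rule: inc_induct)
  case base
  then show ?case using last by simp
next
  case (step s)
  let ?b = "real (Suc s)"
  have r: "real r > 0" using step.hyps by simp
  show ?case
  proof (cases "D (Suc s) = 0")
    case True
    then show ?thesis using nn[of s] step.hyps by simp
  next
    case False
    then have pos: "D (Suc s) > 0" using nn[of "Suc s"] by simp
    have IH: "(?b + 1) * (real r * D (Suc (Suc s))) \<le> (real r - ?b) * D (Suc s)"
      using step.IH by (simp add: algebra_simps)
    \<comment> \<open>Multiplying by \<open>?b - 1 = s\<close> produces the coefficient
      \<open>?b^2 - 1\<close> of the Moon--Moser inequality.\<close>
    have "(?b - 1) * ((?b + 1) * (real r * D (Suc (Suc s)))) \<le> (?b - 1) * ((real r - ?b) * D (Suc s))"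
      by (rule mult_left_mono[OF IH]) simp
    then have "real r * (D (Suc s) + (?b\<^sup>2 - 1) * D (Suc (Suc s))) \<le> ?b * (real r - real s) * D (Suc s)"
      by (simp add: algebra_simps power2_eq_square)
    then have "D s * (real r * (D (Suc s) + (?b\<^sup>2 - 1) * D (Suc (Suc s)))) \<le> D s * (?b * (real r - real s) * D (Suc s))"
      by (rule mult_left_mono[OF _ nn])
    moreover have "real r * (?b\<^sup>2 * (D (Suc s))\<^sup>2) \<le> real r * (D s * (D (Suc s) + (?b\<^sup>2 - 1) * D (Suc (Suc s))))"
      using MM[OF step.hyps(2)] r by (intro mult_left_mono) auto
    ultimately have "(?b * D (Suc s)) * (?b * real r * D (Suc s)) \<le> (?b * D (Suc s)) * ((real r - real s) * D s)"
      by (simp add: mult_ac power2_eq_square)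
    then show ?thesis using pos by (simp add: mult_le_cancel_left)
  qed
qed

text \<open>The ratio bound carries the lower bound at \<open>t\<close> down to all smaller sizes
  and the value at 0 up to upper bounds at all sizes, so everything up to \<open>t\<close> is exact.
  Beyond \<open>t\<close> the Moon--Moser inequality is read the other way: exact values at
  \<open>s\<close> and \<open>s + 1\<close> force a lower bound at \<open>s + 2\<close>.\<close>

lemma clique_density_extremal:
  fixes D :: "nat \<Rightarrow> real"
  assumes nn: "\<And>s. D s \<ge> 0" and last: "D (Suc r) = 0" and D0: "D 0 = 1" and D1: "D (Suc 0) = 1"
    and MM: "\<And>s. s < r \<Longrightarrow> (real (Suc s))\<^sup>2 * (D (Suc s))\<^sup>2 \<le>
        D s * (D (Suc s) + ((real (Suc s))\<^sup>2 - 1) * D (Suc (Suc s)))"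
    and t: "2 \<le> t" "t \<le> r" and Dt: "D t \<ge> turan_density r t"
    and "s \<le> r"
  shows "D s = turan_density r s"
proof -
  have r: "r > 0" using t by simp
  note ratio = clique_density_ratio[of D r, OF nn last MM]
  note ratio' = turan_density_Suc[OF r]
  have down: "D s \<ge> turan_density r s" if "s \<le> t" for s
    using that
  proof (induction s rule: inc_induct)
    case base
    then show ?case by (rule Dt)
  next
    case (step s)
    have "(real r - real s) * turan_density r s = real (Suc s) * real r * turan_density r (Suc s)"
      using ratio'[of s] step.hyps t by simp
    also have "\<dots> \<le> real (Suc s) * real r * D (Suc s)"
      using step.IH by (intro mult_left_mono) auto
    also have "\<dots> \<le> (real r - real s) * D s"
      using ratio[of s] step.hyps t by simp
    finally show ?case using step.hyps t by simp
  qed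
  have up: "D s \<le> turan_density r s" if "s \<le> r" for s
    using that
  proof (induction s)
    case 0
    then show ?case by (simp add: D0 turan_density_0)
  next
    case (Suc s)
    have "real (Suc s) * real r * D (Suc s) \<le> (real r - real s) * D s"
      using ratio[of s] Suc.prems by simp
    also have "\<dots> \<le> (real r - real s) * turan_density r s"
      using Suc by (intro mult_left_mono) auto
    also have "\<dots> = real (Suc s) * real r * turan_density r (Suc s)"
      using ratio'[of s] Suc.prems by simp
    finally show ?case using r by (simp add: mult_le_cancel_left)
  qed
  show ?thesis
  proof (cases "s \<le> 2")
    case True
    then show ?thesis using up[OF \<open>s \<le> r\<close>] down[of s] t by simp
  next
    case False
    \<comment> \<open>The induction has to start from the pair of sizes 1 and 2: for
      \<open>s = 0\<close> the coefficient of \<open>D (s + 2)\<close> vanishes and the inequality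
      says nothing about it. This is where \<open>t \<ge> 2\<close> enters, giving exactness at
      2.\<close>
    have "Suc s \<le> r \<longrightarrow> D (Suc s) = turan_density r (Suc s) \<and> D s = turan_density r s" if "s \<ge> 1" for s
      using that
    proof (induction s rule: nat_induct_at_least)
      case base
      then show ?case using up[of 2] down[of 2] t r by (auto simp: numeral_2_eq_2 D1 turan_density_1)
    next
      case (Suc s)
      show ?case
      proof
        assume s: "Suc (Suc s) \<le> r"
        let ?b = "real (Suc s)"
        have eq: "D (Suc s) = turan_density r (Suc s)" "D s = turan_density r s" using Suc s by auto
        have pos: "D (Suc s) > 0" using turan_density_pos[OF r] s eq by simp
        have ratio_s: "(real r - real s) * D s = ?b * real r * D (Suc s)"
          using ratio'[of s] s eq by simp
        have "(real r - real s) * (?b\<^sup>2 * (D (Suc s))\<^sup>2) \<le>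
            (real r - real s) * (D s * (D (Suc s) + (?b\<^sup>2 - 1) * D (Suc (Suc s))))"
          using s by (intro mult_left_mono MM) auto
        also have "\<dots> = ?b * real r * D (Suc s) * (D (Suc s) + (?b\<^sup>2 - 1) * D (Suc (Suc s)))"
          by (simp only: mult.assoc[symmetric] ratio_s)
        finally have "(?b * D (Suc s)) * ((real r - real s) * (?b * D (Suc s))) \<le>
            (?b * D (Suc s)) * (real r * (D (Suc s) + (?b\<^sup>2 - 1) * D (Suc (Suc s))))"
          by (simp add: mult_ac power2_eq_square)
        then have "(real r - real s) * (?b * D (Suc s)) \<le> real r * (D (Suc s) + (?b\<^sup>2 - 1) * D (Suc (Suc s)))"
          using pos by (simp add: mult_le_cancel_left)
        then have "(?b - 1) * ((real r - ?b) * D (Suc s)) \<le> (?b - 1) * ((?b + 1) * real r * D (Suc (Suc s)))"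
          by (simp add: algebra_simps power2_eq_square)
        then have "(real r - ?b) * D (Suc s) \<le> (?b + 1) * real r * D (Suc (Suc s))"
          using \<open>s \<ge> 1\<close> by (simp add: mult_le_cancel_left)
        then have "real (Suc (Suc s)) * real r * turan_density r (Suc (Suc s)) \<le> real (Suc (Suc s)) * real r * D (Suc (Suc s))"
          using ratio'[of "Suc s"] s eq by (simp add: algebra_simps)
        then have "turan_density r (Suc (Suc s)) \<le> D (Suc (Suc s))"
          using r by (simp add: mult_le_cancel_left)
        then show "D (Suc (Suc s)) = turan_density r (Suc (Suc s)) \<and> D (Suc s) = turan_density r (Suc s)"
          using up[OF s] eq by simp
      qed
    qed
    from this[of "s - 1"] show ?thesis using False \<open>s \<le> r\<close> by auto
  qed
qed

text \<open>Bolzano--Weierstrass, one coordinate at a time. The type is general because it is used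
  both for real densities and for complex eigenpairs.\<close>

lemma finite_common_subsequence:
  fixes f :: "'i \<Rightarrow> nat \<Rightarrow> 'b::heine_borel"
  assumes "finite I" "\<And>i. i \<in> I \<Longrightarrow> bounded (range (f i))"
  shows "\<exists>\<phi> l. strict_mono \<phi> \<and> (\<forall>i\<in>I. (\<lambda>k. f i (\<phi> k)) \<longlonglongrightarrow> l i)"
  using assms
proof (induction I rule: finite_induct)
  case empty
  show ?case by (intro exI[of _ id]) (auto simp: strict_mono_def)
next
  case (insert i I)
  then obtain \<phi> l where \<phi>: "strict_mono \<phi>" "\<forall>i\<in>I. (\<lambda>k. f i (\<phi> k)) \<longlonglongrightarrow> l i" by blast
  have "bounded (range (\<lambda>k. f i (\<phi> k)))"
    using insert.prems[of i] by (rule bounded_subset) auto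
  then obtain m \<psi> where \<psi>: "strict_mono \<psi>" "(\<lambda>k. f i (\<phi> (\<psi> k))) \<longlonglongrightarrow> m"
    using bounded_imp_convergent_subsequence[of "\<lambda>k. f i (\<phi> k)"] by (auto simp: o_def)
  have "\<forall>j\<in>I. (\<lambda>k. f j (\<phi> (\<psi> k))) \<longlonglongrightarrow> l j"
    using \<phi>(2) LIMSEQ_subseq_LIMSEQ[OF _ \<psi>(1)] by (fastforce simp: o_def)
  then show ?case
    using \<phi>(1) \<psi> insert.hyps
    by (intro exI[of _ "\<phi> \<circ> \<psi>"] exI[of _ "l(i := m)"]) (auto simp: strict_mono_def)
qed

text \<open>Normalised to total weight 1. The bounds 0 and 1 supply the compactness, and the
  inequalities reach exactly up to the index \<open>r + 1\<close>.\<close>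

definition moon_moser_sequence :: "nat \<Rightarrow> (nat \<Rightarrow> real) \<Rightarrow> bool" where
  "moon_moser_sequence r d \<longleftrightarrow> d 0 = 1 \<and> d (Suc 0) = 1 \<and> (\<forall>s. 0 \<le> d s \<and> d s \<le> 1) \<and>
    (\<forall>s<r. (real (Suc s))\<^sup>2 * (d (Suc s))\<^sup>2 \<le> d s * (d (Suc s) + ((real (Suc s))\<^sup>2 - 1) * d (Suc (Suc s))))"

text \<open>By compactness: counterexamples for tolerances tending to 0 have a subsequence
  converging at every size up to \<open>r + 1\<close>, and the limit satisfies the exact hypotheses
  of \<open>clique_density_extremal\<close>. No explicit \<open>\<delta>\<close> results.\<close>

lemma clique_density_stability:
  assumes t: "2 \<le> t" "t \<le> r" and "\<epsilon> > 0"
  shows "\<exists>\<delta>>0. \<forall>d. moon_moser_sequence r d \<and> d (Suc r) \<le> \<delta> \<and> d t \<ge> turan_density r t - \<delta>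
    \<longrightarrow> (\<forall>s\<le>r. \<bar>d s - turan_density r s\<bar> \<le> \<epsilon>)"
proof (rule ccontr)
  define \<delta> :: "nat \<Rightarrow> real" where "\<delta> k = 1 / real (Suc k)" for k
  have \<delta>: "\<delta> k > 0" for k by (simp add: \<delta>_def)
  assume "\<not> ?thesis"
  then have "\<exists>d. moon_moser_sequence r d \<and> d (Suc r) \<le> \<delta> k \<and> d t \<ge> turan_density r t - \<delta> k
      \<and> (\<exists>s\<le>r. \<bar>d s - turan_density r s\<bar> > \<epsilon>)" for k
    using \<delta>[of k] by (meson not_le)
  then obtain d where d: "\<And>k. moon_moser_sequence r (d k)" "\<And>k. d k (Suc r) \<le> \<delta> k"
      "\<And>k. d k t \<ge> turan_density r t - \<delta> k" "\<And>k. \<exists>s\<le>r. \<bar>d k s - turan_density r s\<bar> > \<epsilon>"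
    by metis
  have range: "0 \<le> d k s" "d k s \<le> 1" for k s using d(1) by (auto simp: moon_moser_sequence_def)
  have "bounded (range (\<lambda>k. d k s))" for s
    by (rule bounded_subset[of "{0..1}"]) (auto simp: range)
  then obtain \<phi> D where \<phi>: "strict_mono \<phi>" and lim: "\<And>s. s \<le> Suc r \<Longrightarrow> (\<lambda>k. d (\<phi> k) s) \<longlonglongrightarrow> D s"
    using finite_common_subsequence[of "{..Suc r}" "\<lambda>s k. d k s"] by (metis atMost_iff finite_atMost)
  have lim\<delta>: "(\<lambda>k. \<delta> (\<phi> k)) \<longlonglongrightarrow> 0"
    using LIMSEQ_subseq_LIMSEQ[OF _ \<phi>, of \<delta> 0] unfolding \<delta>_def o_def
    using LIMSEQ_inverse_real_of_nat by (simp add: inverse_eq_divide)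
  \<comment> \<open>Convergence is only known up to \<open>r + 1\<close>, whereas nonnegativity is
    required at every index, so the limit is continued by 0.\<close>
  define E where "E s = (if s \<le> Suc r then D s else 0)" for s
  have "E s = turan_density r s" if "s \<le> r" for s
  proof (rule clique_density_extremal[OF _ _ _ _ _ t _ that])
    show "E s \<ge> 0" for s
      using LIMSEQ_le_const[OF lim[of s], of 0] range by (auto simp: E_def)
    have "D (Suc r) \<le> 0"
      using LIMSEQ_le[OF lim[of "Suc r"] lim\<delta>] d(2) by auto
    then show "E (Suc r) = 0"
      using LIMSEQ_le_const[OF lim[of "Suc r"], of 0] range by (auto simp: E_def)
    show "E 0 = 1" "E (Suc 0) = 1"
      using LIMSEQ_unique[OF lim[of 0], of 1] LIMSEQ_unique[OF lim[of "Suc 0"], of 1] d(1)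
      by (auto simp: E_def moon_moser_sequence_def)
    show "turan_density r t \<le> E t"
    proof -
      have "turan_density r t - 0 \<le> D t"
        using t d(3) by (intro LIMSEQ_le[OF tendsto_diff[OF tendsto_const lim\<delta>] lim[of t]]) auto
      then show ?thesis using t by (simp add: E_def)
    qed
    show "(real (Suc s))\<^sup>2 * (E (Suc s))\<^sup>2 \<le> E s * (E (Suc s) + ((real (Suc s))\<^sup>2 - 1) * E (Suc (Suc s)))"
      if "s < r" for s
    proof -
      have "(\<lambda>k. (real (Suc s))\<^sup>2 * (d (\<phi> k) (Suc s))\<^sup>2) \<longlonglongrightarrow> (real (Suc s))\<^sup>2 * (D (Suc s))\<^sup>2"
        using that by (intro tendsto_intros lim) auto
      moreover have "(\<lambda>k. d (\<phi> k) s * (d (\<phi> k) (Suc s) + ((real (Suc s))\<^sup>2 - 1) * d (\<phi> k) (Suc (Suc s))))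
          \<longlonglongrightarrow> D s * (D (Suc s) + ((real (Suc s))\<^sup>2 - 1) * D (Suc (Suc s)))"
        using that by (intro tendsto_intros lim) auto
      ultimately have "(real (Suc s))\<^sup>2 * (D (Suc s))\<^sup>2 \<le> D s * (D (Suc s) + ((real (Suc s))\<^sup>2 - 1) * D (Suc (Suc s)))"
        by (rule LIMSEQ_le) (use d(1) that in \<open>auto simp del: of_nat_Suc simp: moon_moser_sequence_def\<close>)
      then show ?thesis using that by (simp add: E_def)
    qed
  qed
  then have "(\<lambda>k. d (\<phi> k) s) \<longlonglongrightarrow> turan_density r s" if "s \<le> r" for s
    using lim[of s] that by (simp add: E_def)
  then have "\<forall>s\<in>{..r}. eventually (\<lambda>k. \<bar>d (\<phi> k) s - turan_density r s\<bar> < \<epsilon>) sequentially"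
    using \<open>\<epsilon> > 0\<close> by (auto simp: tendsto_iff dist_real_def)
  then have "eventually (\<lambda>k. \<forall>s\<in>{..r}. \<bar>d (\<phi> k) s - turan_density r s\<bar> < \<epsilon>) sequentially"
    by (simp add: eventually_ball_finite)
  then obtain k where "\<forall>s\<in>{..r}. \<bar>d (\<phi> k) s - turan_density r s\<bar> < \<epsilon>"
    by (auto simp: eventually_sequentially)
  then show False using d(4)[of "\<phi> k"] by (metis atMost_iff less_asym)
qed

section \<open>Few cliques in \<open>H\<close>-free graphs\<close>

lemma lists_Suc_conv:
  "{xs. set xs \<subseteq> V \<and> length xs = Suc q} = (\<lambda>(v, xs). v # xs) ` (V \<times> {xs. set xs \<subseteq> V \<and> length xs = q})"
  by (auto simp: length_Suc_conv image_iff)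

text \<open>A complete \<open>q\<close>-partite \<open>q\<close>-uniform pattern with parts of size
  \<open>h\<close>, as in the theorem of Erdos. The parts may overlap in general; when
  \<open>P\<close> consists of tuples enumerating cliques of size \<open>q\<close>, a common vertex
  would produce a tuple with a repetition, so they are then disjoint.\<close>

definition contains_box :: "nat \<Rightarrow> nat \<Rightarrow> 'b set \<Rightarrow> 'b list set \<Rightarrow> bool" where
  "contains_box h q V P \<longleftrightarrow> (\<exists>As. length As = q \<and> (\<forall>A\<in>set As. A \<subseteq> V \<and> card A = h) \<and>
    (\<forall>xs. list_all2 (\<in>) xs As \<longrightarrow> xs \<in> P))"

text \<open>Fix \<open>M\<close> vertices with large links, for a constant \<open>M\<close>. A positive fraction of the \<open>q\<close>-tuples
  extends by at least \<open>h\<close> of them, and by pigeonhole on the \<open>2 ^ M\<close> subsets a positive fraction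
  does so with the same \<open>h\<close> vertices.\<close>

lemma dense_contains_box:
  fixes \<eta> :: real and V :: "'b set"
  assumes "\<eta> > 0"
  shows "\<exists>n0. \<forall>V::'b set. \<forall>P. finite V \<and> card V \<ge> n0 \<and> P \<subseteq> {xs. set xs \<subseteq> V \<and> length xs = q} \<and>
      real (card P) \<ge> \<eta> * real (card V) ^ q \<longrightarrow>
    contains_box h q V P"
  using assms
proof (induction q arbitrary: \<eta>)
  case 0
  have "contains_box h 0 V P" if "P \<subseteq> {[]}" "\<eta> \<le> real (card P)" for V :: "'b set" and P
  proof -
    have "P \<noteq> {}" using that 0 by auto
    then have "P = {[]}" using that(1) by blast
    then show ?thesis by (simp add: contains_box_def)
  qed
  then show ?case by (intro exI[of _ 0]) auto
next
  case (Suc q)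
  \<comment> \<open>Large enough that a tuple extended by a fraction \<open>\<eta> / 4\<close> of
    the \<open>M\<close> vertices is extended by at least \<open>h\<close> of them.\<close>
  define M where "M = Suc (nat \<lceil>4 * real h / \<eta>\<rceil>)"
  have M: "M > 0" "(\<eta> / 4) * real M \<ge> real h"
  proof -
    have "4 * real h / \<eta> \<le> real M" unfolding M_def by linarith
    then show "(\<eta> / 4) * real M \<ge> real h" using Suc.prems by (simp add: field_simps)
  qed (simp add: M_def)
  \<comment> \<open>At least a fraction \<open>\<eta> / 4\<close> of all \<open>q\<close>-tuples
    will have many extensions; they are divided among the \<open>2 ^ M\<close> subsets of the chosen
    vertices.\<close>
  define \<eta>' where "\<eta>' = (\<eta> / 4) / 2 ^ M"
  have "\<eta>' > 0" using Suc.prems by (simp add: \<eta>'_def)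
  from Suc.IH[OF this] obtain n0 where n0: "\<And>(V::'b set) P. finite V \<Longrightarrow> card V \<ge> n0 \<Longrightarrow>
      P \<subseteq> {xs. set xs \<subseteq> V \<and> length xs = q} \<Longrightarrow> real (card P) \<ge> \<eta>' * real (card V) ^ q \<Longrightarrow>
      contains_box h q V P"
    by blast
  show ?case
  \<comment> \<open>The second bound ensures \<open>M \<le> \<eta> / 2 * n\<close>, so that there
    are \<open>M\<close> vertices with large links to choose from.\<close>
  proof (intro exI[of _ "max n0 (nat \<lceil>2 * real M / \<eta>\<rceil>)"] allI impI)
    fix V :: "'b set" and P
    let ?L = "{xs. set xs \<subseteq> V \<and> length xs = q}"
    define n where "n = card V"
    assume "finite V \<and> max n0 (nat \<lceil>2 * real M / \<eta>\<rceil>) \<le> card V \<and>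
      P \<subseteq> {xs. set xs \<subseteq> V \<and> length xs = Suc q} \<and> \<eta> * real (card V) ^ Suc q \<le> real (card P)"
    then have V: "finite V" and n: "n \<ge> n0" "2 * real M / \<eta> \<le> real n"
      and P: "P \<subseteq> {xs. set xs \<subseteq> V \<and> length xs = Suc q}" and cP: "\<eta> * real n ^ Suc q \<le> real (card P)"
      by (auto simp: n_def)
    have Mn: "real M \<le> \<eta> / 2 * real n" using n(2) Suc.prems by (simp add: field_simps)
    then have npos: "real n > 0" using M(1) Suc.prems by (cases "n = 0") auto
    have finL: "finite ?L" and cL: "card ?L = n ^ q"
      using finite_lists_length_eq[OF V] card_lists_length_eq[OF V] by (auto simp: n_def)
    define lnk where "lnk v = {xs \<in> ?L. v # xs \<in> P}" for v
    have sub_lnk: "lnk v \<subseteq> ?L" for v by (auto simp: lnk_def)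
    have fin_lnk: "finite (lnk v)" for v by (rule finite_subset[OF sub_lnk finL])
    have lnk_le: "real (card (lnk v)) \<le> real n ^ q" for v
      using card_mono[OF finL sub_lnk, of v] cL by (simp flip: of_nat_power)
    have "P = (\<lambda>(v, xs). v # xs) ` Sigma V lnk"
      using P unfolding lists_Suc_conv by (fastforce simp: lnk_def)
    then have "card P = (\<Sum>v\<in>V. card (lnk v))"
      using V fin_lnk by (simp add: card_image inj_on_def)
    then have sumP: "\<eta> * real n ^ Suc q \<le> (\<Sum>v\<in>V. real (card (lnk v)))"
      using cP by simp
    define Vh where "Vh = {v \<in> V. real (card (lnk v)) \<ge> \<eta> / 2 * real n ^ q}"
    have "(\<Sum>v\<in>V. real (card (lnk v))) \<le> (\<Sum>v\<in>V. (if v \<in> Vh then real n ^ q else 0) + \<eta> / 2 * real n ^ q)"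
      using lnk_le Suc.prems by (intro sum_mono) (auto simp: Vh_def add_increasing2)
    also have "\<dots> = real (card Vh) * real n ^ q + real n * (\<eta> / 2 * real n ^ q)"
      using V by (simp add: sum.distrib sum.If_cases Vh_def Int_def n_def)
    finally have "real n ^ q * (\<eta> / 2 * real n) \<le> real n ^ q * real (card Vh)"
      using sumP by (simp add: algebra_simps)
    then have "\<eta> / 2 * real n \<le> real (card Vh)"
      using npos by (simp add: mult_le_cancel_left)
    then have "M \<le> card Vh" using Mn by linarith
    then obtain U where U: "U \<subseteq> Vh" "card U = M" "finite U" by (meson obtain_subset_with_card_n)
    have UV: "U \<subseteq> V" using U by (auto simp: Vh_def)
    \<comment> \<open>From here the incidences between the \<open>M\<close> vertices of
      \<open>U\<close> and the \<open>q\<close>-tuples are counted from both sides.\<close>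
    define D where "D xs = {v \<in> U. v # xs \<in> P}" for xs
    have D_le: "card (D xs) \<le> M" for xs using card_mono[OF U(3), of "D xs"] U(2) by (auto simp: D_def)
    have "real M * (\<eta> / 2 * real n ^ q) = (\<Sum>v\<in>U. \<eta> / 2 * real n ^ q)" using U by simp
    also have "\<dots> \<le> (\<Sum>v\<in>U. real (card (lnk v)))" using U by (intro sum_mono) (auto simp: Vh_def)
    also have "\<dots> = (\<Sum>v\<in>U. \<Sum>xs\<in>?L. if v # xs \<in> P then 1 else 0)"
      using finL by (simp add: lnk_def sum.If_cases Int_def)
    also have "\<dots> = (\<Sum>xs\<in>?L. \<Sum>v\<in>U. if v # xs \<in> P then 1 else 0)"
      by (rule sum.swap)
    also have "\<dots> = (\<Sum>xs\<in>?L. real (card (D xs)))"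
      using U(3) by (simp add: D_def sum.If_cases Int_def)
    finally have sumD: "real M * (\<eta> / 2 * real n ^ q) \<le> (\<Sum>xs\<in>?L. real (card (D xs)))" .
    define X where "X = {xs \<in> ?L. real (card (D xs)) \<ge> \<eta> / 4 * real M}"
    have finX: "finite X" by (rule finite_subset[OF _ finL]) (auto simp: X_def)
    have "(\<Sum>xs\<in>?L. real (card (D xs))) \<le> (\<Sum>xs\<in>?L. (if xs \<in> X then real M else 0) + \<eta> / 4 * real M)"
      using D_le Suc.prems by (intro sum_mono) (auto simp: X_def add_increasing2)
    also have "\<dots> = real (card X) * real M + real n ^ q * (\<eta> / 4 * real M)"
    proof -
      have "?L \<inter> {xs. xs \<in> X} = X" by (auto simp: X_def)
      then show ?thesis using finL cL by (simp add: sum.distrib sum.If_cases)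
    qed
    finally have "real M * (\<eta> / 4 * real n ^ q) \<le> real M * real (card X)"
      using sumD by (simp add: algebra_simps)
    then have cX: "\<eta> / 4 * real n ^ q \<le> real (card X)"
      using M(1) by (simp add: mult_le_cancel_left)
    have "(\<Sum>T\<in>Pow U. \<Sum>xs | xs \<in> X \<and> D xs = T. 1 :: real) = (\<Sum>xs\<in>X. 1)"
      by (rule sum.group) (use U(3) finX in \<open>auto simp: D_def\<close>)
    then have cXs: "real (card X) = (\<Sum>T\<in>Pow U. real (card {xs \<in> X. D xs = T}))" by simp
    have "\<exists>T\<in>Pow U. real (card {xs \<in> X. D xs = T}) \<ge> \<eta>' * real n ^ q"
    proof (rule ccontr)
      assume "\<not> ?thesis"
      then have "(\<Sum>T\<in>Pow U. real (card {xs \<in> X. D xs = T})) < (\<Sum>T\<in>Pow U. \<eta>' * real n ^ q)"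
        using U(3) by (intro sum_strict_mono) (auto simp: not_le)
      also have "\<dots> = \<eta> / 4 * real n ^ q" using U by (simp add: card_Pow \<eta>'_def)
      finally show False using cX cXs by simp
    qed
    then obtain T where T: "T \<subseteq> U" "real (card {xs \<in> X. D xs = T}) \<ge> \<eta>' * real n ^ q" by auto
    have "0 < \<eta>' * real n ^ q" using npos \<open>\<eta>' > 0\<close> by simp
    then have "card {xs \<in> X. D xs = T} \<noteq> 0" using T(2) by (metis not_le of_nat_0)
    then obtain xs0 where "xs0 \<in> X" "D xs0 = T" by (metis (mono_tags, lifting) card.empty empty_Collect_eq)
    then have "real h \<le> real (card T)" using M(2) by (auto simp: X_def)
    then obtain A where A: "A \<subseteq> T" "card A = h" by (metis of_nat_le_iff obtain_subset_with_card_n)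
    have "{xs \<in> X. D xs = T} \<subseteq> ?L" by (auto simp: X_def)
    from n0[OF V n(1)[unfolded n_def] this] T(2) obtain As where As: "length As = q"
        "\<forall>A\<in>set As. A \<subseteq> V \<and> card A = h" "\<forall>xs. list_all2 (\<in>) xs As \<longrightarrow> xs \<in> {xs \<in> X. D xs = T}"
      unfolding n_def contains_box_def by blast
    have "xs \<in> P" if xs: "list_all2 (\<in>) xs (A # As)" for xs
    proof -
      obtain v ys where "xs = v # ys" "v \<in> A" "list_all2 (\<in>) ys As"
        using xs by (auto simp: list_all2_Cons2)
      then show ?thesis using As(3) A(1) by (auto simp: D_def)
    qed
    then show "contains_box h (Suc q) V P"
      unfolding contains_box_def using As A T UV by (intro exI[of _ "A # As"]) auto
  qed
qed

section \<open>Embedding a coloured graph into a box\<close>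

lemma proper_coloring_chromatic_number:
  assumes "simple_graph H"
  shows "\<exists>c. proper_coloring H (chromatic_number H) c"
proof -
  have fin: "finite (verts H)" using assms by (simp add: simple_graph_def)
  then obtain c where c: "bij_betw c (verts H) {0..<card (verts H)}"
    using ex_bij_betw_finite_nat by blast
  have "proper_coloring H (card (verts H)) c"
    unfolding proper_coloring_def
  proof (intro conjI ballI impI)
    fix u v assume *: "u \<in> verts H" "v \<in> verts H" "{u, v} \<in> edges H"
    then have "card {u, v} = 2" using assms by (auto simp: simple_graph_def)
    then have "u \<noteq> v" by auto
    then show "c u \<noteq> c v" using * c by (auto simp: bij_betw_def inj_on_def)
  qed (use c in \<open>auto simp: bij_betw_def\<close>)
  then have "\<exists>k. \<exists>c. proper_coloring H k c" by blast
  then show ?thesis unfolding chromatic_number_def by (rule LeastI_ex)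
qed

text \<open>Each vertex of \<open>H\<close> is sent into the part indexed by its colour. Adjacent
  vertices have different colours, so their images lie on a common transversal of the box, which is
  a clique.\<close>

lemma box_of_cliques_not_H_free:
  assumes "simple_graph G" "simple_graph H" "proper_coloring H q c"
    and As: "length As = q" "\<And>A. A \<in> set As \<Longrightarrow> A \<subseteq> verts G \<and> card A = card (verts H)"
    and box: "\<And>xs. list_all2 (\<in>) xs As \<Longrightarrow> set xs \<in> cliques q G"
  shows "\<not> H_free H G"
proof (cases "verts H = {}")
  case True
  then have "edges H = {}" using assms(2) by (fastforce simp: simple_graph_def)
  then have "subgraph_of H' G \<and> isomorphic H H'" if "H' = \<lparr>verts = {}, edges = {}\<rparr>" for H'
    using True that by (auto simp: subgraph_of_def isomorphic_def simple_graph_def bij_betw_def)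
  then show ?thesis by (auto simp: H_free_def)
next
  case False
  have finH: "finite (verts H)" using assms(2) by (simp add: simple_graph_def)
  have c: "c v < q" if "v \<in> verts H" for v using assms(3) that by (auto simp: proper_coloring_def)
  have "\<exists>f. inj_on f (verts H) \<and> f ` verts H \<subseteq> A" if "A \<in> set As" for A
  proof -
    have "card (verts H) > 0" using False finH by (simp add: card_gt_0_iff)
    then have "finite A" using As(2)[OF that] by (metis card_ge_0_finite)
    then show ?thesis using As(2)[OF that] finH by (metis card_le_inj le_refl)
  qed
  then have "\<exists>f. inj_on f (verts H) \<and> f ` verts H \<subseteq> As ! i" if "i < q" for i
    using As(1) nth_mem that by metis
  then obtain f where f: "\<And>i. i < q \<Longrightarrow> inj_on (f i) (verts H) \<and> f i ` verts H \<subseteq> As ! i"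
    by metis
  \<comment> \<open>Each \<open>f i\<close> is injective on all of \<open>H\<close>, so vertices of
    the same colour stay distinct; vertices of different colours are separated by the clique
    property.\<close>
  define g where "g v = f (c v) v" for v
  have fA: "f i v \<in> As ! i" if "i < q" "v \<in> verts H" for i v using f[OF that(1)] that(2) by blast
  obtain v0 where v0: "v0 \<in> verts H" using False by blast
  have adj: "{g u, g v} \<in> edges G \<and> g u \<noteq> g v" if uv: "u \<in> verts H" "v \<in> verts H" "c u \<noteq> c v" for u v
  proof -
    \<comment> \<open>A transversal through \<open>g u\<close> and \<open>g v\<close>; the vertex
      \<open>v0\<close> merely supplies some element of every other part.\<close>
    define xs where "xs = map (\<lambda>i. if i = c u then g u else if i = c v then g v else f i v0) [0..<q]"
    have "list_all2 (\<in>) xs As"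
      unfolding list_all2_conv_all_nth using As(1) by (simp add: xs_def g_def fA v0 uv)
    then have xs: "set xs \<in> cliques q G" by (rule box)
    have "length xs = q" by (simp add: xs_def)
    then have dist: "distinct xs" using cliquesD(3)[OF xs] by (simp add: card_distinct)
    have at: "xs ! c u = g u" "xs ! c v = g v" "c u < length xs" "c v < length xs"
      using c uv by (auto simp: xs_def)
    have "g u \<noteq> g v" using nth_eq_iff_index_eq[OF dist at(3,4)] at uv(3) by simp
    moreover have "g u \<in> set xs" "g v \<in> set xs" using nth_mem[OF at(3)] nth_mem[OF at(4)] at by simp_all
    ultimately have "{g u, g v} \<in> edges G \<and> g u \<noteq> g v" using cliquesD(4)[OF xs] by blast
    then show ?thesis .
  qed
  have inj: "inj_on g (verts H)"
  proof (rule inj_onI)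
    fix u v assume *: "u \<in> verts H" "v \<in> verts H" "g u = g v"
    then have "c u = c v" using adj by metis
    then show "u = v" using * f[OF c] by (auto simp: g_def inj_on_def)
  qed
  have gV: "g v \<in> verts G" if "v \<in> verts H" for v
  proof -
    have "g v \<in> As ! c v" using fA[OF c[OF that] that] by (simp add: g_def)
    moreover have "As ! c v \<in> set As" using c[OF that] As(1) by simp
    ultimately show ?thesis using As(2) by blast
  qed
  have edgeH: "\<exists>u v. e = {u, v} \<and> u \<noteq> v \<and> u \<in> verts H \<and> v \<in> verts H \<and> c u \<noteq> c v" if "e \<in> edges H" for e
  proof -
    have "e \<subseteq> verts H" "card e = 2" using assms(2) that by (auto simp: simple_graph_def)
    then obtain u v where "e = {u, v}" "u \<noteq> v" by (auto simp: card_2_iff)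
    moreover from this have "c u \<noteq> c v"
      using that \<open>e \<subseteq> verts H\<close> assms(3) by (simp add: proper_coloring_def)
    ultimately show ?thesis using \<open>e \<subseteq> verts H\<close> by blast
  qed
  \<comment> \<open>Only images of edges of \<open>H\<close> are kept: \<open>G\<close> may have
    further edges between these vertices, and the copy need not be induced.\<close>
  define K where "K = \<lparr>verts = g ` verts H, edges = (`) g ` edges H\<rparr>"
  have "simple_graph K \<and> edges K \<subseteq> edges G"
  proof -
    have "e' \<subseteq> verts K \<and> card e' = 2 \<and> e' \<in> edges G" if e': "e' \<in> edges K" for e'
    proof -
      obtain e where e: "e \<in> edges H" "e' = g ` e" using e' by (auto simp: K_def)
      from edgeH[OF e(1)] obtain u v where "e = {u, v}" "u \<in> verts H" "v \<in> verts H" "c u \<noteq> c v" by blast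
      then show ?thesis using adj e by (auto simp: K_def)
    qed
    then show ?thesis using finH by (auto simp: simple_graph_def K_def)
  qed
  moreover have "isomorphic H K"
  proof -
    have "{u, v} \<in> edges H \<longleftrightarrow> {g u, g v} \<in> edges K" if "u \<in> verts H" "v \<in> verts H" for u v
    proof
      assume "{g u, g v} \<in> edges K"
      then obtain e where e: "e \<in> edges H" "g ` {u, v} = g ` e" by (auto simp: K_def)
      moreover have "e \<subseteq> verts H" using e(1) assms(2) by (auto simp: simple_graph_def)
      ultimately have "{u, v} = e" using that inj_on_image_eq_iff[OF inj, of "{u, v}" e] by auto
      then show "{u, v} \<in> edges H" using e by simp
    next
      assume "{u, v} \<in> edges H"
      then have "g ` {u, v} \<in> edges K" unfolding K_def by (simp only: graph.simps image_eqI)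
      then show "{g u, g v} \<in> edges K" by simp
    qed
    then show ?thesis using inj by (auto simp: isomorphic_def bij_betw_def K_def intro!: exI[of _ g])
  qed
  moreover have "verts K \<subseteq> verts G" using gV by (auto simp: K_def)
  ultimately show ?thesis by (auto simp: H_free_def subgraph_of_def)
qed

text \<open>Every clique is enumerated by at least one list. Too many cliques would make these lists
  dense, and the resulting box would contain \<open>H\<close>.\<close>

lemma H_free_few_cliques:
  fixes H :: "'a graph" and \<eta> :: real
  assumes "simple_graph H" "\<eta> > 0"
  shows "\<exists>n0. \<forall>G :: 'b graph. simple_graph G \<and> card (verts G) \<ge> n0 \<and> H_free H G \<longrightarrow>
    real (card (cliques (chromatic_number H) G)) \<le> \<eta> * real (card (verts G)) ^ chromatic_number H"
proof -
  define q where "q = chromatic_number H"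
  obtain c where c: "proper_coloring H q c"
    using proper_coloring_chromatic_number[OF assms(1)] by (auto simp: q_def)
  obtain n0 where n0: "\<And>(V::'b set) P. finite V \<Longrightarrow> card V \<ge> n0 \<Longrightarrow> P \<subseteq> {xs. set xs \<subseteq> V \<and> length xs = q} \<Longrightarrow>
      real (card P) \<ge> \<eta> * real (card V) ^ q \<Longrightarrow>
      contains_box (card (verts H)) q V P"
    using dense_contains_box[OF assms(2), of q "card (verts H)"] by blast
  have "real (card (cliques q G)) \<le> \<eta> * real (card (verts G)) ^ q"
    if G: "simple_graph G" "card (verts G) \<ge> n0" "H_free H G" for G :: "'b graph"
  proof (rule ccontr)
    assume *: "\<not> ?thesis"
    let ?P = "{xs. set xs \<subseteq> verts G \<and> length xs = q \<and> set xs \<in> cliques q G}"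
    have fin: "finite (verts G)" using G(1) by (simp add: simple_graph_def)
    have finP: "finite ?P"
      by (rule finite_subset[OF _ finite_lists_length_eq[OF fin, of q]]) auto
    have "cliques q G \<subseteq> set ` ?P"
    proof
      fix S assume S: "S \<in> cliques q G"
      obtain xs where "set xs = S" "distinct xs" using finite_distinct_list[OF cliquesD(2)[OF S]] by auto
      then show "S \<in> set ` ?P" using S cliquesD[OF S] distinct_card[of xs] by auto
    qed
    then have "card (cliques q G) \<le> card ?P"
      using surj_card_le[OF finP] by blast
    then have "real (card ?P) \<ge> \<eta> * real (card (verts G)) ^ q" using * by linarith
    from n0[OF fin G(2) _ this] obtain As where "length As = q"
      "\<forall>A\<in>set As. A \<subseteq> verts G \<and> card A = card (verts H)" "\<forall>xs. list_all2 (\<in>) xs As \<longrightarrow> xs \<in> ?P"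
      unfolding contains_box_def by blast
    then have "\<not> H_free H G"
      by (intro box_of_cliques_not_H_free[OF G(1) assms(1) c, of As]) auto
    then show False using G(3) by simp
  qed
  then show ?thesis unfolding q_def by blast
qed

section \<open>A partition from a typical clique\<close>

lemma clique_weight_one: "clique_weight G (\<lambda>_. 1) s = real (card (cliques s G))"
  by (simp add: clique_weight_def)

lemma codegree_one: "codegree G (\<lambda>_. 1) J = real (card (common_nbrs G J))"
  by (simp add: codegree_def)

text \<open>Averaging over all \<open>r\<close>-cliques \<open>K\<close>: typically the common neighbourhoods of the sets
  \<open>K - {x}\<close> cover almost all vertices, and an edge inside one of them extends \<open>K - {x}\<close> to an
  \<open>(r + 1)\<close>-clique, so there are few such edges.\<close>

lemma exists_good_clique:
  assumes G: "simple_graph G" and n: "n = card (verts G)" and r: "r = Suc s"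
    and k: "\<And>s. k s = real (card (cliques s G))" and pos: "k r > 0"
  shows "\<exists>K\<in>cliques r G.
    real n * (real n - real (card (\<Union>x\<in>K. common_nbrs G (K - {x})))) +
      (\<Sum>x\<in>K. \<Sum>u\<in>common_nbrs G (K - {x}). real (card (common_nbrs G (insert u (K - {x})))))
    \<le> real n ^ 2 - real n * real r ^ 2 * k r / k s + real n * (2 * real r ^ 2 + real r) * k (Suc r) / k r"
proof -
  let ?w = "\<lambda>_ :: 'a. 1 :: real"
  let ?L = "\<lambda>K. real n - real (card (\<Union>x\<in>K. common_nbrs G (K - {x})))"
  let ?C = "\<lambda>K. \<Sum>x\<in>K. \<Sum>u\<in>common_nbrs G (K - {x}). real (card (common_nbrs G (insert u (K - {x}))))"
  let ?d = "\<lambda>K. \<Sum>x\<in>K. codegree G ?w (K - {x})"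
  have finV: "finite (verts G)" using G by (simp add: simple_graph_def)
  have cw: "clique_weight G ?w s = k s" for s by (simp add: clique_weight_one k)
  have sum_cod: "(\<Sum>J\<in>cliques s G. codegree G ?w J) = real (Suc s) * k (Suc s)" for s
    using sum_codegree_clique[OF G, of ?w s] by (simp add: cw)
  have L: "?L K \<le> real n + real s * codegree G ?w K - ?d K" if "K \<in> cliques r G" for K
    using sum_codegree_remove[OF G, of K s ?w] that by (simp add: r)
  have "(\<Sum>K\<in>cliques r G. ?L K) \<le> (\<Sum>K\<in>cliques r G. real n + real s * codegree G ?w K - ?d K)"
    by (intro sum_mono L)
  also have "\<dots> = real n * k r + real s * (real (Suc r) * k (Suc r)) - (\<Sum>K\<in>cliques r G. ?d K)"
    by (simp add: sum_subtractf sum.distrib k mult.commute sum_cod sum_distrib_left[symmetric])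
  finally have sumL: "(\<Sum>K\<in>cliques r G. ?L K) \<le> real n * k r + real s * (real (Suc r) * k (Suc r)) - (\<Sum>K\<in>cliques r G. ?d K)" .
  have CS: "(real r * k r)\<^sup>2 \<le> k s * (\<Sum>K\<in>cliques r G. ?d K)"
    using sum_codegree_squares[OF G, of ?w s] by (simp add: cw r)
  have ks: "k s > 0"
  proof (rule ccontr)
    assume "\<not> ?thesis"
    then have "k s = 0" by (simp add: k)
    then show False using CS pos r by simp
  qed
  \<comment> \<open>Since the total codegree is large on average, the union of the neighbourhoods
    must cover most vertices on average.\<close>
  have d: "real r ^ 2 * k r * (k r / k s) \<le> (\<Sum>K\<in>cliques r G. ?d K)"
    using CS ks by (simp add: field_simps power2_eq_square)
  \<comment> \<open>With \<open>J = K - {x}\<close> the inner sum no longer depends on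
    \<open>x\<close>, which therefore costs only a factor \<open>n\<close>. The remaining sets
    \<open>insert u J\<close> are again \<open>r\<close>-cliques, and their codegrees count
    \<open>(r + 1)\<close>-cliques.\<close>
  have "(\<Sum>K\<in>cliques r G. ?C K) =
      (\<Sum>J\<in>cliques s G. \<Sum>x\<in>common_nbrs G J. \<Sum>u\<in>common_nbrs G J. codegree G ?w (insert u J))"
    using sum_clique_remove[OF G, of "\<lambda>J x. \<Sum>u\<in>common_nbrs G J. codegree G ?w (insert u J)" s]
    by (simp add: codegree_one r)
  also have "\<dots> \<le> (\<Sum>J\<in>cliques s G. real n * (\<Sum>u\<in>common_nbrs G J. codegree G ?w (insert u J)))"
    using card_mono[OF finV, of "common_nbrs G _"]
    by (auto intro!: sum_mono mult_right_mono sum_nonneg simp: codegree_one n common_nbrs_def)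
  also have "\<dots> = real n * (\<Sum>K\<in>cliques r G. \<Sum>x\<in>K. codegree G ?w (insert x (K - {x})))"
    using sum_clique_remove[OF G, of "\<lambda>J x. codegree G ?w (insert x J)" s]
    by (simp only: sum_distrib_left[symmetric] r)
  also have "(\<Sum>K\<in>cliques r G. \<Sum>x\<in>K. codegree G ?w (insert x (K - {x}))) = (\<Sum>K\<in>cliques r G. real r * codegree G ?w K)"
    by (intro sum.cong refl) (simp add: insert_absorb cliquesD)
  also have "\<dots> = real r * (real (Suc r) * k (Suc r))"
    by (simp add: sum_distrib_left[symmetric] sum_cod)
  finally have sumC: "(\<Sum>K\<in>cliques r G. ?C K) \<le> real n * (real r * (real (Suc r) * k (Suc r)))" .
  define R where "R = real n ^ 2 - real n * real r ^ 2 * k r / k s + real n * (2 * real r ^ 2 + real r) * k (Suc r) / k r"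
  have kn: "k (Suc r) \<ge> 0" by (simp add: k)
  have "(\<Sum>K\<in>cliques r G. real n * ?L K + ?C K) = real n * (\<Sum>K\<in>cliques r G. ?L K) + (\<Sum>K\<in>cliques r G. ?C K)"
    by (simp add: sum.distrib sum_distrib_left)
  also have "\<dots> \<le> real n * (real n * k r + real s * (real (Suc r) * k (Suc r)) - real r ^ 2 * k r * (k r / k s))
      + real n * (real r * (real (Suc r) * k (Suc r)))"
    using sumL d by (intro add_mono sumC mult_left_mono) auto
  \<comment> \<open>The coefficient is \<open>(r - 1) * (r + 1) + r * (r + 1)\<close>, from overlaps
    and from edges inside the neighbourhoods.\<close>
  also have "\<dots> = k r * (real n ^ 2 - real n * real r ^ 2 * k r / k s) + real n * (2 * real r ^ 2 + real r - 1) * k (Suc r)"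
    by (simp add: r algebra_simps power2_eq_square add_divide_distrib)
  also have "\<dots> \<le> k r * (real n ^ 2 - real n * real r ^ 2 * k r / k s) + real n * (2 * real r ^ 2 + real r) * k (Suc r)"
    using kn by (intro add_left_mono mult_right_mono mult_left_mono) auto
  also have "\<dots> = k r * R" using pos by (simp add: R_def distrib_left)
  also have "\<dots> = (\<Sum>K\<in>cliques r G. R)" by (simp add: k)
  finally have le: "(\<Sum>K\<in>cliques r G. real n * ?L K + ?C K) \<le> (\<Sum>K\<in>cliques r G. R)" .
  have "cliques r G \<noteq> {}" using pos by (auto simp: k)
  then have "\<exists>K\<in>cliques r G. real n * ?L K + ?C K \<le> R"
    using le sum_strict_mono[OF finite_cliques[OF G, of r], of "\<lambda>_. R" "\<lambda>K. real n * ?L K + ?C K"] by (meson not_le)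
  then show ?thesis by (simp add: R_def)
qed

text \<open>A vertex joins the first neighbourhood containing it. An edge inside a part either meets
  the uncovered set, accounting for at most \<open>2 * n\<close> ordered pairs per uncovered vertex,
  or joins two vertices of one neighbourhood. The second term is doubled as well only to match the
  quantity bounded before.\<close>

lemma clique_partition:
  assumes G: "simple_graph G" and n: "n = card (verts G)" and K: "K \<in> cliques r G" and r: "r > 0"
  shows "\<exists>p :: 'a \<Rightarrow> nat. (\<forall>v. p v < r) \<and>
    real (card {(u, v) \<in> verts G \<times> verts G. {u, v} \<in> edges G \<and> p u = p v}) \<le>
    2 * (real n * (real n - real (card (\<Union>x\<in>K. common_nbrs G (K - {x})))) +
      (\<Sum>x\<in>K. \<Sum>u\<in>common_nbrs G (K - {x}). real (card (common_nbrs G (insert u (K - {x}))))))"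
proof -
  let ?N = "\<lambda>x. common_nbrs G (K - {x})"
  have finV: "finite (verts G)" using G by (simp add: simple_graph_def)
  have NV: "?N x \<subseteq> verts G" for x by (auto simp: common_nbrs_def)
  obtain h where h: "bij_betw h {0..<r} K"
    using ex_bij_betw_nat_finite[of K] cliquesD[OF K] by auto
  \<comment> \<open>Uncovered vertices are put into part 0, which exists since
    \<open>r > 0\<close>.\<close>
  define p where "p v = (if \<exists>i<r. v \<in> ?N (h i) then LEAST i. i < r \<and> v \<in> ?N (h i) else 0)" for v
  have p: "p v < r \<and> v \<in> ?N (h (p v))" if "v \<in> (\<Union>x\<in>K. ?N x)" for v
  proof -
    have "\<exists>i<r. v \<in> ?N (h i)" using that h by (auto simp: bij_betw_def)
    then show ?thesis unfolding p_def by (simp only: if_True) (rule LeastI_ex)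
  qed
  have p_less: "p v < r" for v
  proof (cases "\<exists>i<r. v \<in> ?N (h i)")
    case True
    then have "v \<in> (\<Union>x\<in>K. ?N x)" using h by (auto simp: bij_betw_def)
    then show ?thesis using p by blast
  next
    case False
    then show ?thesis unfolding p_def using r by (simp only: if_False)
  qed
  define W where "W = (\<Union>x\<in>K. ?N x)"
  define R where "R = verts G - W"
  define E where "E x = Sigma (?N x) (\<lambda>u. common_nbrs G (insert u (K - {x})))" for x
  have WV: "W \<subseteq> verts G" using NV by (auto simp: W_def)
  have card_R: "real (card R) = real n - real (card W)"
    using card_Diff_subset[OF finite_subset[OF WV finV] WV] card_mono[OF finV WV] by (simp add: R_def n)
  have finE: "finite (E x)" for x
    unfolding E_def using finite_common_nbrs[OF G] by auto
  let ?P = "{(u, v) \<in> verts G \<times> verts G. {u, v} \<in> edges G \<and> p u = p v}"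
  let ?Q = "(\<Union>x\<in>K. E x) \<union> (R \<times> verts G \<union> verts G \<times> R)"
  have sub: "?P \<subseteq> ?Q"
  proof
    fix z assume "z \<in> ?P"
    then obtain u v where uv: "z = (u, v)" "u \<in> verts G" "v \<in> verts G" "{u, v} \<in> edges G" "p u = p v" by blast
    show "z \<in> ?Q"
    proof (cases "u \<in> W \<and> v \<in> W")
      case True
      then have "u \<in> ?N (h (p u))" "v \<in> ?N (h (p u))" "h (p u) \<in> K"
        using p[of u] p[of v] uv(5) h by (auto simp: W_def bij_betw_def)
      then show ?thesis using uv by (auto simp: E_def common_nbrs_def)
    qed (use uv in \<open>auto simp: R_def\<close>)
  qed
  have finR: "finite R" using finV by (simp add: R_def)
  have finK: "finite K" using cliquesD(2)[OF K] .
  have "card ?P \<le> card ?Q" using finE finK finV finR by (intro card_mono[OF _ sub]) auto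
  also have "\<dots> \<le> card (\<Union>x\<in>K. E x) + card (R \<times> verts G \<union> verts G \<times> R)" by (rule card_Un_le)
  also have "\<dots> \<le> (\<Sum>x\<in>K. card (E x)) + (card (R \<times> verts G) + card (verts G \<times> R))"
    by (intro add_mono card_UN_le finK card_Un_le)
  finally have "real (card ?P) \<le> real ((\<Sum>x\<in>K. card (E x)) + (card (R \<times> verts G) + card (verts G \<times> R)))"
    by (rule of_nat_mono)
  also have "\<dots> = (\<Sum>x\<in>K. real (card (E x))) + 2 * (real n * real (card R))"
    by (simp add: card_cartesian_product n)
  also have "(\<Sum>x\<in>K. real (card (E x))) = (\<Sum>x\<in>K. \<Sum>u\<in>?N x. real (card (common_nbrs G (insert u (K - {x})))))"
    unfolding E_def using finite_common_nbrs[OF G] by simp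
  finally have "real (card ?P) \<le> 2 * (real n * real (card R) + (\<Sum>x\<in>K. \<Sum>u\<in>?N x. real (card (common_nbrs G (insert u (K - {x}))))))"
    using sum_nonneg[of K "\<lambda>x. \<Sum>u\<in>?N x. real (card (common_nbrs G (insert u (K - {x}))))"]
    by (smt (verit) of_nat_0_le_iff sum_nonneg)
  then show ?thesis using p_less unfolding card_R W_def by blast
qed

lemma card_adjacent_pairs:
  assumes "simple_graph G"
  shows "real (card {(u, v) \<in> verts G \<times> verts G. {u, v} \<in> edges G}) = 2 * real (card (cliques 2 G))"
proof -
  have "{(u, v) \<in> verts G \<times> verts G. {u, v} \<in> edges G} = Sigma (verts G) (\<lambda>u. common_nbrs G {u})"
    by (auto simp: common_nbrs_def)
  then have "real (card {(u, v) \<in> verts G \<times> verts G. {u, v} \<in> edges G}) = (\<Sum>u\<in>verts G. real (card (common_nbrs G {u})))"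
    using assms finite_common_nbrs[OF assms] by (simp add: simple_graph_def)
  also have "\<dots> = (\<Sum>J\<in>cliques (Suc 0) G. real (card (common_nbrs G J)))"
    by (simp add: cliques_1 sum.reindex)
  also have "\<dots> = 2 * real (card (cliques 2 G))"
    using sum_codegree_clique[OF assms, of "\<lambda>_. 1" "Suc 0"] by (simp add: clique_weight_one codegree_one numeral_2_eq_2)
  finally show ?thesis .
qed

section \<open>From a partition to the Turan graph\<close>

text \<open>Induction on the total excess. Subtraction on naturals truncates, so the sum sees only
  overfull classes; moving one vertex from an overfull to an underfull class lowers it by exactly
  one.\<close>

lemma rebalance_partition:
  fixes p :: "'b \<Rightarrow> nat" and b :: "nat \<Rightarrow> nat"
  assumes "finite V" "\<forall>v\<in>V. p v < r" "(\<Sum>i<r. b i) = card V"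
  shows "\<exists>p'. (\<forall>v\<in>V. p' v < r) \<and> (\<forall>i<r. card {v \<in> V. p' v = i} = b i) \<and>
    card {v \<in> V. p v \<noteq> p' v} \<le> (\<Sum>i<r. card {v \<in> V. p v = i} - b i)"
  using assms(2)
proof (induction "\<Sum>i<r. card {v \<in> V. p v = i} - b i" arbitrary: p)
  case 0
  let ?a = "\<lambda>i. card {v \<in> V. p v = i}"
  have sum_a: "(\<Sum>i<r. ?a i) = card V"
    using 0(2) assms(1) sum.group[of V "{..<r}" p "\<lambda>_. 1 :: nat"] by auto
  have le: "?a i \<le> b i" if "i < r" for i
    using 0(1) that by simp
  have "?a i = b i" if "i < r" for i
  proof (rule ccontr)
    assume "?a i \<noteq> b i"
    then have "(\<Sum>i<r. ?a i) < (\<Sum>i<r. b i)"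
      using le that by (intro sum_strict_mono_ex1) (auto intro!: bexI[of _ i] simp: le_neq_implies_less)
    then show False using sum_a assms(3) by simp
  qed
  then show ?case using 0(2) by (intro exI[of _ p]) auto
next
  case (Suc m)
  let ?a = "\<lambda>i. card {v \<in> V. p v = i}"
  have sum_a: "(\<Sum>i<r. ?a i) = card V"
    using Suc.prems assms(1) sum.group[of V "{..<r}" p "\<lambda>_. 1 :: nat"] by auto
  have "\<exists>i<r. b i < ?a i"
  proof (rule ccontr)
    assume "\<not> ?thesis"
    then have "\<forall>i<r. ?a i \<le> b i" by (meson not_le)
    then have "(\<Sum>i<r. ?a i - b i) = 0" by simp
    then show False using Suc.hyps(2) by simp
  qed
  then obtain i where i: "i < r" "b i < ?a i" by blast
  have "\<exists>j<r. ?a j < b j"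
  proof (rule ccontr)
    assume "\<not> ?thesis"
    then have "\<forall>i<r. b i \<le> ?a i" by (meson not_le)
    then have "(\<Sum>i<r. b i) < (\<Sum>i<r. ?a i)"
      using i by (intro sum_strict_mono_ex1) auto
    then show False using sum_a assms(3) by simp
  qed
  then obtain j where j: "j < r" "?a j < b j" by blast
  have "{v \<in> V. p v = i} \<noteq> {}" using i(2) by (metis card.empty not_less_zero)
  then obtain v0 where v0: "v0 \<in> V" "p v0 = i" by blast
  define q where "q = p(v0 := j)"
  have ij: "i \<noteq> j" using i j by auto
  have ai: "card {v \<in> V. q v = i} = ?a i - 1"
  proof -
    have "{v \<in> V. q v = i} = {v \<in> V. p v = i} - {v0}" using ij by (auto simp: q_def)
    then show ?thesis using v0 by simp
  qed
  have aj: "card {v \<in> V. q v = j} = Suc (?a j)"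
  proof -
    have "{v \<in> V. q v = j} = insert v0 {v \<in> V. p v = j}" using v0 by (auto simp: q_def)
    then show ?thesis using v0 assms(1) ij by simp
  qed
  have ak: "card {v \<in> V. q v = k} = ?a k" if "k \<noteq> i" "k \<noteq> j" for k
    using that v0 by (intro arg_cong[of _ _ card]) (auto simp: q_def)
  \<comment> \<open>Class \<open>j\<close> was underfull, so after receiving a vertex its truncated
    excess is still 0.\<close>
  have pt: "?a k - b k = (card {v \<in> V. q v = k} - b k) + (if k = i then 1 else 0)" for k
    using ai aj ak[of k] ij i j by (cases "k = i"; cases "k = j") auto
  have "(\<Sum>k<r. ?a k - b k) = (\<Sum>k<r. (card {v \<in> V. q v = k} - b k) + (if k = i then 1 else 0))"
    by (intro sum.cong refl pt)
  also have "\<dots> = (\<Sum>k<r. card {v \<in> V. q v = k} - b k) + 1"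
    using i(1) by (simp add: sum.distrib)
  finally have m: "m = (\<Sum>k<r. card {v \<in> V. q v = k} - b k)" using Suc.hyps(2) by simp
  have "\<forall>v\<in>V. q v < r" using Suc.prems j by (simp add: q_def)
  from Suc.hyps(1)[OF m this] obtain p' where p': "\<forall>v\<in>V. p' v < r" "\<forall>i<r. card {v \<in> V. p' v = i} = b i"
    "card {v \<in> V. q v \<noteq> p' v} \<le> m" using m by blast
  have "card {v \<in> V. p v \<noteq> p' v} \<le> card (insert v0 {v \<in> V. q v \<noteq> p' v})"
    using assms(1) by (intro card_mono) (auto simp: q_def)
  also have "\<dots> \<le> Suc m" using p'(3) card_insert_le_m1[of "Suc m" "{v \<in> V. q v \<noteq> p' v}" v0] by simp
  finally show ?case using p' Suc.hyps(2) by (intro exI[of _ p']) simp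
qed

lemma sum_balanced_sizes:
  assumes "r > 0"
  shows "(\<Sum>i<r. n div r + (if i < n mod r then 1 else 0)) = (n :: nat)"
proof -
  have "(\<Sum>i<r. if i < n mod r then 1 else 0 :: nat) = card ({..<r} \<inter> {i. i < n mod r})"
    by (simp add: sum.If_cases)
  also have "{..<r} \<inter> {i. i < n mod r} = {..<n mod r}" using assms by (auto intro: less_trans)
  finally show ?thesis by (simp add: sum.distrib)
qed

text \<open>One count of ordered pairs gives both estimates. The pairs within parts number at least
  \<open>n^2 / r\<close>, with surplus equal to the variance sum of the part sizes. As few edges lie
  within parts and the total is nearly maximal, both the number of missing crossing pairs and this
  surplus are at most \<open>2 * \<gamma> * n^2\<close>. Hence few vertices have to be moved to
  balance the parts.\<close>

lemma near_turan_graph: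
  fixes G :: "'b graph" and p :: "'b \<Rightarrow> nat" and \<gamma> :: real
  assumes G: "simple_graph G" and r: "r > 0" and p: "\<forall>v\<in>verts G. p v < r" and n: "n = card (verts G)"
    and mono: "real (card {(u, v) \<in> verts G \<times> verts G. {u, v} \<in> edges G \<and> p u = p v}) \<le> \<gamma> * real n ^ 2"
    and dense: "real (card {(u, v) \<in> verts G \<times> verts G. {u, v} \<in> edges G}) \<ge> (1 - 1 / real r - \<gamma>) * real n ^ 2"
  shows "\<exists>T. is_turan_graph r n T \<and> verts T = verts G \<and>
    real (card ((edges G - edges T) \<union> (edges T - edges G))) \<le> (3 * \<gamma> + real r * sqrt (2 * \<gamma>)) * real n ^ 2 + real r * real n"
proof -
  define V where "V = verts G"
  have finV: "finite V" and edgeD: "\<And>e. e \<in> edges G \<Longrightarrow> e \<subseteq> V \<and> card e = 2"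
    using G by (auto simp: simple_graph_def V_def)
  have cV: "card V = n" by (simp add: n V_def)
  have pV: "\<And>v. v \<in> V \<Longrightarrow> p v < r" using p by (simp add: V_def)
  define E where "E = {(u, v) \<in> V \<times> V. {u, v} \<in> edges G}"
  \<comment> \<open>The diagonal is included, so \<open>S\<close> has exactly the sum of the squared
    part sizes as its cardinality.\<close>
  define S where "S = {(u, v) \<in> V \<times> V. p u = p v}"
  define M where "M = V \<times> V - S - E"
  have fin: "finite E" "finite S" "finite M" "finite (V \<times> V)"
    unfolding E_def S_def M_def using finV by (auto intro: finite_subset[of _ "V \<times> V"])
  have sub: "E \<subseteq> V \<times> V" "S \<subseteq> V \<times> V" by (auto simp: E_def S_def)
  have mono': "real (card (E \<inter> S)) \<le> \<gamma> * real n ^ 2"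
  proof -
    have "E \<inter> S = {(u, v) \<in> verts G \<times> verts G. {u, v} \<in> edges G \<and> p u = p v}"
      by (auto simp: E_def S_def V_def)
    then show ?thesis using mono by simp
  qed
  have dense': "real (card E) \<ge> (1 - 1 / real r - \<gamma>) * real n ^ 2"
    using dense by (simp add: E_def V_def)
  define a where "a i = card {v \<in> V. p v = i}" for i
  have sum_a: "(\<Sum>i<r. real (a i)) = real n"
    using sum.group[of V "{..<r}" p "\<lambda>_. 1 :: real"] finV pV cV by (auto simp: a_def)
  have card_S: "real (card S) = (\<Sum>i<r. real (a i) ^ 2)"
  proof -
    have "S = (\<Union>i\<in>{..<r}. {v \<in> V. p v = i} \<times> {v \<in> V. p v = i})" using pV by (auto simp: S_def)
    then have "card S = (\<Sum>i<r. card ({v \<in> V. p v = i} \<times> {v \<in> V. p v = i}))"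
      using finV by (simp only:) (rule card_UN_disjoint, auto)
    then show ?thesis by (simp add: a_def card_cartesian_product power2_eq_square)
  qed
  have "card (V \<times> V) = card S + card (E - S) + card M"
  proof -
    have "V \<times> V = (S \<union> (E - S)) \<union> M" using sub by (auto simp: M_def)
    moreover have "card ((S \<union> (E - S)) \<union> M) = card (S \<union> (E - S)) + card M"
      using fin by (intro card_Un_disjoint) (auto simp: M_def)
    moreover have "card (S \<union> (E - S)) = card S + card (E - S)"
      using fin by (intro card_Un_disjoint) auto
    ultimately show ?thesis by simp
  qed
  moreover have "card E = card (E \<inter> S) + card (E - S)"
    using fin by (metis card_Diff_subset_Int card_mono finite_Int inf_le1 le_add_diff_inverse)
  ultimately have count: "real n ^ 2 = real (card S) + real (card E) - real (card (E \<inter> S)) + real (card M)"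
    by (simp add: card_cartesian_product cV power2_eq_square flip: of_nat_mult of_nat_add)
  have variance: "(\<Sum>i<r. (real (a i) - real n / real r) ^ 2) = real (card S) - real n ^ 2 / real r"
  proof -
    have "(\<Sum>i<r. (real (a i) - real n / real r) ^ 2) =
        (\<Sum>i<r. real (a i) ^ 2) - 2 * (real n / real r) * (\<Sum>i<r. real (a i)) + real r * (real n / real r) ^ 2"
      by (simp add: power2_diff sum.distrib sum_subtractf sum_distrib_left sum_divide_distrib mult_ac)
    also have "\<dots> = real (card S) - real n ^ 2 / real r"
      using r unfolding card_S[symmetric] sum_a by (simp add: field_simps power2_eq_square)
    finally show ?thesis .
  qed
  have "0 \<le> real (card S) - real n ^ 2 / real r" unfolding variance[symmetric] by (intro sum_nonneg) simp
  moreover have "real n ^ 2 - real n ^ 2 / real r - \<gamma> * real n ^ 2 \<le> real (card E)"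
    using dense' by (simp add: algebra_simps)
  ultimately have card_M: "real (card M) \<le> 2 * \<gamma> * real n ^ 2"
    and card_S_le: "real (card S) - real n ^ 2 / real r \<le> 2 * \<gamma> * real n ^ 2"
    using count mono' by linarith+
  have var_le: "(\<Sum>i<r. (real (a i) - real n / real r) ^ 2) \<le> 2 * \<gamma> * real n ^ 2"
    unfolding variance by (rule card_S_le)
  have dev: "\<bar>real (a i) - real n / real r\<bar> \<le> sqrt (2 * \<gamma>) * real n" if "i < r" for i
  proof -
    have "(real (a i) - real n / real r) ^ 2 \<le> 2 * \<gamma> * real n ^ 2"
      using member_le_sum[of i "{..<r}" "\<lambda>i. (real (a i) - real n / real r) ^ 2"] that var_le by simp
    then have "sqrt ((real (a i) - real n / real r) ^ 2) \<le> sqrt (2 * \<gamma> * real n ^ 2)"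
      by (rule real_sqrt_le_mono)
    then show ?thesis by (simp add: real_sqrt_mult)
  qed
  define b where "b i = n div r + (if i < n mod r then 1 else 0)" for i
  have "(\<Sum>i<r. b i) = card V" unfolding b_def cV by (rule sum_balanced_sizes[OF r])
  from rebalance_partition[OF finV _ this, of p] pV obtain p' where p': "\<forall>v\<in>V. p' v < r"
    "\<forall>i<r. card {v \<in> V. p' v = i} = b i" "card {v \<in> V. p v \<noteq> p' v} \<le> (\<Sum>i<r. a i - b i)"
    unfolding a_def by blast
  define D where "D = {v \<in> V. p v \<noteq> p' v}"
  have ab: "real (a i - b i) \<le> sqrt (2 * \<gamma>) * real n + 1" if "i < r" for i
  proof -
    have "real n = real r * real (n div r) + real (n mod r)"
      by (metis mult_div_mod_eq of_nat_add of_nat_mult)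
    moreover have "real (n mod r) \<le> real r" using r by (simp add: less_imp_le)
    ultimately have "real n / real r \<le> real (n div r) + 1" using r by (simp add: field_simps)
    then have "real n / real r - 1 \<le> real (b i)" by (simp add: b_def)
    moreover have "0 \<le> sqrt (2 * \<gamma>) * real n" using dev[OF that] by linarith
    moreover have "real (a i - b i) \<le> max 0 (real (a i) - real (b i))" by linarith
    ultimately show ?thesis using dev[OF that] by linarith
  qed
  have card_D: "real (card D) \<le> real r * (sqrt (2 * \<gamma>) * real n + 1)"
  proof -
    have "real (card D) \<le> (\<Sum>i<r. real (a i - b i))" using p'(3) by (simp add: D_def flip: of_nat_sum)
    also have "\<dots> \<le> (\<Sum>i<r. sqrt (2 * \<gamma>) * real n + 1)" by (intro sum_mono ab) simp
    finally show ?thesis by simp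
  qed
  define T where "T = \<lparr>verts = V, edges = {{u, v} | u v. u \<in> V \<and> v \<in> V \<and> p' u \<noteq> p' v}\<rparr>"
  have turan: "is_turan_graph r n T"
    unfolding is_turan_graph_def using finV cV p'(1,2) by (auto simp: T_def b_def intro!: exI[of _ p'])
  let ?\<Delta> = "(edges G - edges T) \<union> (edges T - edges G)"
  \<comment> \<open>A discrepancy is an edge within a part, a missing crossing pair, or a pair
    meeting a moved vertex. Up to order these contribute \<open>\<gamma>\<close>,
    \<open>2 * \<gamma>\<close> and the square root term; rounding of the part sizes gives the
    linear term.\<close>
  let ?U = "(E \<inter> S) \<union> M \<union> D \<times> V"
  have "?\<Delta> \<subseteq> (\<lambda>(u, v). {u, v}) ` ?U"
  proof
    fix e assume e: "e \<in> ?\<Delta>"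
    obtain u v where uv: "e = {u, v}" "u \<in> V" "v \<in> V" "e \<in> edges G \<longrightarrow> p' u = p' v" "e \<notin> edges G \<longrightarrow> p' u \<noteq> p' v"
    proof (cases "e \<in> edges G")
      case True
      then obtain u v where uv: "e = {u, v}" "u \<in> V" "v \<in> V" using edgeD[of e] by (auto simp: card_2_iff)
      moreover have "p' u = p' v" using e True uv by (auto simp: T_def)
      ultimately show thesis using that True by blast
    next
      case False
      then have "e \<in> edges T" using e by blast
      then show thesis using that False by (auto simp: T_def)
    qed
    have "(u, v) \<in> ?U \<or> (v, u) \<in> ?U"
    proof (cases "u \<in> D \<or> v \<in> D")
      case False
      then have eq: "p u = p' u" "p v = p' v" using uv by (auto simp: D_def)
      show ?thesis
      proof (cases "e \<in> edges G")
        case True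
        then have "(u, v) \<in> E \<inter> S" using uv eq by (simp add: E_def S_def)
        then show ?thesis by blast
      next
        case False
        then have "(u, v) \<in> M" using uv eq by (simp add: E_def S_def M_def)
        then show ?thesis by blast
      qed
    qed (use uv in blast)
    moreover have "{u, v} = {v, u}" by blast
    ultimately show "e \<in> (\<lambda>(u, v). {u, v}) ` ?U" unfolding uv(1) by (metis (mono_tags, lifting) case_prod_conv image_eqI)
  qed
  moreover have finU: "finite ?U" using fin finV by (auto simp: D_def)
  ultimately have "card ?\<Delta> \<le> card ?U" by (rule surj_card_le[rotated])
  also have "\<dots> \<le> card (E \<inter> S) + card M + card (D \<times> V)"
    by (meson add_le_mono card_Un_le le_refl order_trans)
  finally have "real (card ?\<Delta>) \<le> real (card (E \<inter> S)) + real (card M) + real (card D) * real n"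
    by (simp add: card_cartesian_product cV flip: of_nat_add of_nat_mult)
  also have "\<dots> \<le> \<gamma> * real n ^ 2 + 2 * \<gamma> * real n ^ 2 + real r * (sqrt (2 * \<gamma>) * real n + 1) * real n"
    using mono' card_M card_D by (intro add_mono mult_right_mono) auto
  also have "\<dots> = (3 * \<gamma> + real r * sqrt (2 * \<gamma>)) * real n ^ 2 + real r * real n"
    by (simp add: algebra_simps power2_eq_square)
  finally show ?thesis using turan by (intro exI[of _ T]) (auto simp: T_def V_def)
qed

section \<open>Eigenvalues of the clique tensor\<close>

lemma sum_lists_Suc:
  assumes "finite V"
  shows "(\<Sum>xs | length xs = Suc q \<and> set xs \<subseteq> V. g xs) =
    (\<Sum>v\<in>V. \<Sum>xs | length xs = q \<and> set xs \<subseteq> V. g (v # xs))"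
proof -
  have "{xs. length xs = Suc q \<and> set xs \<subseteq> V} = (\<lambda>(v, xs). v # xs) ` (V \<times> {xs. length xs = q \<and> set xs \<subseteq> V})"
    by (auto simp: length_Suc_conv image_iff)
  then show ?thesis
    by (simp add: sum.reindex inj_on_def sum.cartesian_product split_def)
qed

lemma sum_lists_prod:
  fixes x :: "'b \<Rightarrow> 'c::comm_semiring_1"
  assumes "finite V"
  shows "(\<Sum>xs | length xs = q \<and> set xs \<subseteq> V. \<Prod>v\<leftarrow>xs. x v) = sum x V ^ q"
proof (induction q)
  case 0
  have "{xs. length xs = 0 \<and> set xs \<subseteq> V} = {[]}" by auto
  then show ?case by (simp only:) simp
next
  case (Suc q)
  have "(\<Sum>xs | length xs = Suc q \<and> set xs \<subseteq> V. \<Prod>v\<leftarrow>xs. x v) =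
    (\<Sum>v\<in>V. x v * (\<Sum>xs | length xs = q \<and> set xs \<subseteq> V. \<Prod>v\<leftarrow>xs. x v))"
    by (simp only: sum_lists_Suc[OF assms] list.map prod_list.Cons sum_distrib_left)
  then show ?case by (simp add: Suc.IH sum_distrib_right)
qed

lemma norm_prod_list: "cmod (\<Prod>v\<leftarrow>xs. x v) = (\<Prod>v\<leftarrow>xs. cmod (x v))"
  by (induction xs) (auto simp: norm_mult)

lemma prod_list_mult_const: "(\<Prod>v\<leftarrow>xs. c * x v) = (c :: 'c::comm_semiring_1) ^ length xs * (\<Prod>v\<leftarrow>xs. x v)"
  by (induction xs) (auto simp: mult_ac)

lemma prod_list_le_power:
  fixes x :: "'b \<Rightarrow> real"
  assumes "\<And>v. v \<in> set xs \<Longrightarrow> 0 \<le> x v \<and> x v \<le> M"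
  shows "0 \<le> (\<Prod>v\<leftarrow>xs. x v) \<and> (\<Prod>v\<leftarrow>xs. x v) \<le> M ^ length xs"
  using assms
proof (induction xs)
  case (Cons a xs)
  then show ?case by (auto intro!: mult_mono mult_nonneg_nonneg order_trans[of 0 "x a" M])
qed simp

text \<open>Both sides of the equation are homogeneous of degree \<open>m - 1\<close>. Normalising
  the sum of the moduli, a continuous function, keeps limits of eigenvectors nonzero.\<close>

lemma tensor_eigenvalue_scaled:
  assumes "tensor_eigenvalue m n A \<mu>"
  obtains x where "(\<Sum>i\<in>{1..n}. cmod (x i)) = 1"
    "\<And>i. i \<in> {1..n} \<Longrightarrow> \<mu> * x i ^ (m - 1) =
      (\<Sum>js | length js = m - 1 \<and> set js \<subseteq> {1..n}. A (i # js) * (\<Prod>j\<leftarrow>js. x j))"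
proof -
  obtain x where x: "\<exists>i\<in>{1..n}. x i \<noteq> 0" and eq: "\<And>i. i \<in> {1..n} \<Longrightarrow> \<mu> * x i ^ (m - 1) =
      (\<Sum>js | length js = m - 1 \<and> set js \<subseteq> {1..n}. A (i # js) * (\<Prod>j\<leftarrow>js. x j))"
    using assms unfolding tensor_eigenvalue_def by blast
  define N where "N = (\<Sum>i\<in>{1..n}. cmod (x i))"
  define c where "c = complex_of_real (1 / N)"
  obtain i1 where "i1 \<in> {1..n}" "x i1 \<noteq> 0" using x by blast
  then have N: "N > 0" unfolding N_def by (intro sum_pos2[of "{1..n}" i1]) simp_all
  define y where "y i = (if i \<in> {1..n} then c * x i else 0)" for i
  show thesis
  proof
    show "(\<Sum>i\<in>{1..n}. cmod (y i)) = 1"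
      using N by (simp add: y_def c_def norm_mult norm_divide sum_divide_distrib[symmetric] N_def[symmetric] del: One_nat_def)
    fix i assume i: "i \<in> {1..n}"
    have "(\<Sum>js | length js = m - 1 \<and> set js \<subseteq> {1..n}. A (i # js) * (\<Prod>j\<leftarrow>js. y j)) =
        (\<Sum>js | length js = m - 1 \<and> set js \<subseteq> {1..n}. c ^ (m - 1) * (A (i # js) * (\<Prod>j\<leftarrow>js. x j)))"
    proof (rule sum.cong[OF refl])
      fix js assume js: "js \<in> {js. length js = m - 1 \<and> set js \<subseteq> {1..n}}"
      then have "map y js = map (\<lambda>j. c * x j) js" by (auto simp: y_def)
      then show "A (i # js) * (\<Prod>j\<leftarrow>js. y j) = c ^ (m - 1) * (A (i # js) * (\<Prod>j\<leftarrow>js. x j))"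
        using js by (simp only: prod_list_mult_const) simp
    qed
    also have "\<dots> = c ^ (m - 1) * (\<mu> * x i ^ (m - 1))"
      using eq[OF i] by (simp add: sum_distrib_left)
    finally show "\<mu> * y i ^ (m - 1) = (\<Sum>js | length js = m - 1 \<and> set js \<subseteq> {1..n}. A (i # js) * (\<Prod>j\<leftarrow>js. y j))"
      using i by (simp add: y_def power_mult_distrib mult_ac)
  qed
qed

text \<open>The triangle inequality turns the complex equations into real inequalities for moduli.
  Here the maximum is normalised, so that one coordinate equals 1 and the inequality there bounds
  the eigenvalue itself.\<close>

lemma tensor_eigenvalue_modulus:
  assumes "tensor_eigenvalue m n A \<mu>"
  obtains i0 y where "i0 \<in> {1..n}" "y i0 = 1" "\<And>i. 0 \<le> y i \<and> y i \<le> 1"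
    "\<And>i. i \<in> {1..n} \<Longrightarrow> cmod \<mu> * y i ^ (m - 1) \<le>
      (\<Sum>js | length js = m - 1 \<and> set js \<subseteq> {1..n}. cmod (A (i # js)) * (\<Prod>j\<leftarrow>js. y j))"
proof -
  obtain x where x: "\<exists>i\<in>{1..n}. x i \<noteq> 0" and eq: "\<And>i. i \<in> {1..n} \<Longrightarrow> \<mu> * x i ^ (m - 1) =
      (\<Sum>js | length js = m - 1 \<and> set js \<subseteq> {1..n}. A (i # js) * (\<Prod>j\<leftarrow>js. x j))"
    using assms unfolding tensor_eigenvalue_def by blast
  define M where "M = Max ((\<lambda>i. cmod (x i)) ` {1..n})"
  have "{1..n} \<noteq> {}" using x by blast
  then have "M \<in> (\<lambda>i. cmod (x i)) ` {1..n}" unfolding M_def by (intro Max_in) simp_all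
  then obtain i0 where i0: "i0 \<in> {1..n}" "cmod (x i0) = M" by blast
  have le: "cmod (x i) \<le> M" if "i \<in> {1..n}" for i
    unfolding M_def using that by (intro Max_ge) auto
  obtain i1 where "i1 \<in> {1..n}" "x i1 \<noteq> 0" using x by blast
  then have M: "M > 0" using le[of i1] by (meson less_le_trans zero_less_norm_iff)
  \<comment> \<open>The value 0 outside the index range makes the bounds on \<open>y\<close> hold
    for every index.\<close>
  define y where "y i = (if i \<in> {1..n} then (1 / M) * cmod (x i) else 0)" for i
  show thesis
  proof
    show "i0 \<in> {1..n}" by (rule i0)
    show "y i0 = 1" using i0 M by (simp add: y_def)
    show "0 \<le> y i \<and> y i \<le> 1" for i using M le by (simp add: y_def)
    fix i assume i: "i \<in> {1..n}"
    have "cmod \<mu> * cmod (x i) ^ (m - 1) = cmod (\<mu> * x i ^ (m - 1))"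
      by (simp add: norm_mult norm_power)
    also have "\<dots> \<le> (\<Sum>js | length js = m - 1 \<and> set js \<subseteq> {1..n}. cmod (A (i # js)) * (\<Prod>j\<leftarrow>js. cmod (x j)))"
      unfolding eq[OF i] by (rule order_trans[OF norm_sum]) (simp add: norm_mult norm_prod_list)
    finally have "(1 / M) ^ (m - 1) * (cmod \<mu> * cmod (x i) ^ (m - 1)) \<le>
       (1 / M) ^ (m - 1) * (\<Sum>js | length js = m - 1 \<and> set js \<subseteq> {1..n}. cmod (A (i # js)) * (\<Prod>j\<leftarrow>js. cmod (x j)))"
      using M by (intro mult_left_mono) auto
    also have "\<dots> = (\<Sum>js | length js = m - 1 \<and> set js \<subseteq> {1..n}. cmod (A (i # js)) * (\<Prod>j\<leftarrow>js. y j))"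
      unfolding sum_distrib_left
    proof (rule sum.cong[OF refl])
      fix js assume js: "js \<in> {js. length js = m - 1 \<and> set js \<subseteq> {1..n}}"
      then have "map y js = map (\<lambda>j. (1 / M) * cmod (x j)) js" by (auto simp: y_def)
      then show "(1 / M) ^ (m - 1) * (cmod (A (i # js)) * (\<Prod>j\<leftarrow>js. cmod (x j))) = cmod (A (i # js)) * (\<Prod>j\<leftarrow>js. y j)"
        using js by (simp only: prod_list_mult_const) simp
    qed
    finally show "cmod \<mu> * y i ^ (m - 1) \<le> (\<Sum>js | length js = m - 1 \<and> set js \<subseteq> {1..n}. cmod (A (i # js)) * (\<Prod>j\<leftarrow>js. y j))"
      using i by (simp add: y_def power_mult_distrib power_divide mult_ac)
  qed
qed

lemma tensor_eigenvalue_bound: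
  assumes "tensor_eigenvalue m n A \<mu>"
  shows "cmod \<mu> \<le> (\<Sum>i\<in>{1..n}. \<Sum>js | length js = m - 1 \<and> set js \<subseteq> {1..n}. cmod (A (i # js)))"
proof -
  obtain i0 y where y: "i0 \<in> {1..n}" "y i0 = 1" "\<And>i. 0 \<le> y i \<and> y i \<le> 1"
    "\<And>i. i \<in> {1..n} \<Longrightarrow> cmod \<mu> * y i ^ (m - 1) \<le>
      (\<Sum>js | length js = m - 1 \<and> set js \<subseteq> {1..n}. cmod (A (i # js)) * (\<Prod>j\<leftarrow>js. y j))"
    by (rule tensor_eigenvalue_modulus[OF assms]) (rule that)
  have "cmod \<mu> \<le> (\<Sum>js | length js = m - 1 \<and> set js \<subseteq> {1..n}. cmod (A (i0 # js)) * (\<Prod>j\<leftarrow>js. y j))"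
    using y(4)[OF y(1)] y(2) by simp
  also have "\<dots> \<le> (\<Sum>js | length js = m - 1 \<and> set js \<subseteq> {1..n}. cmod (A (i0 # js)))"
    using prod_list_le_power[where x = y and M = 1] y(3) by (intro sum_mono mult_left_le) auto
  also have "\<dots> \<le> (\<Sum>i\<in>{1..n}. \<Sum>js | length js = m - 1 \<and> set js \<subseteq> {1..n}. cmod (A (i # js)))"
    using y(1) by (intro member_le_sum) (auto intro: sum_nonneg)
  finally show ?thesis .
qed

section \<open>Existence of an eigenvalue of largest modulus\<close>

lemma tendsto_prod_list:
  fixes f :: "'b \<Rightarrow> nat \<Rightarrow> complex"
  assumes "\<And>v. v \<in> set xs \<Longrightarrow> f v \<longlonglongrightarrow> l v"
  shows "(\<lambda>k. \<Prod>v\<leftarrow>xs. f v k) \<longlonglongrightarrow> (\<Prod>v\<leftarrow>xs. l v)"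
  using assms by (induction xs) (auto intro!: tendsto_mult)

text \<open>Compactness replaces finiteness of the spectrum: normalised eigenpairs whose moduli tend
  to the supremum have a convergent subsequence, and its limit is again an eigenpair by
  continuity.\<close>

lemma max_tensor_eigenvalue:
  assumes "tensor_eigenvalue m n A \<mu>0"
  shows "\<exists>\<mu>. tensor_eigenvalue m n A \<mu> \<and> (\<forall>\<nu>. tensor_eigenvalue m n A \<nu> \<longrightarrow> cmod \<nu> \<le> cmod \<mu>)"
proof -
  define E where "E = {cmod \<mu> | \<mu>. tensor_eigenvalue m n A \<mu>}"
  have E: "E \<noteq> {}" "bdd_above E"
    using assms tensor_eigenvalue_bound by (auto simp: E_def intro!: bdd_aboveI)
  have "\<exists>\<mu>. tensor_eigenvalue m n A \<mu> \<and> Sup E - 1 / real (Suc k) < cmod \<mu>" for k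
    using less_cSup_iff[OF E, of "Sup E - 1 / real (Suc k)"] by (auto simp: E_def)
  then obtain \<mu> where \<mu>: "\<And>k. tensor_eigenvalue m n A (\<mu> k)" "\<And>k. Sup E - 1 / real (Suc k) < cmod (\<mu> k)"
    by metis
  have "\<exists>x. (\<Sum>i\<in>{1..n}. cmod (x i)) = 1 \<and> (\<forall>i\<in>{1..n}. \<mu> k * x i ^ (m - 1) =
      (\<Sum>js | length js = m - 1 \<and> set js \<subseteq> {1..n}. A (i # js) * (\<Prod>j\<leftarrow>js. x j)))" for k
    by (rule tensor_eigenvalue_scaled[OF \<mu>(1)[of k]]) blast
  then have "\<forall>k. \<exists>x. (\<Sum>i\<in>{1..n}. cmod (x i)) = 1 \<and> (\<forall>i\<in>{1..n}. \<mu> k * x i ^ (m - 1) =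
      (\<Sum>js | length js = m - 1 \<and> set js \<subseteq> {1..n}. A (i # js) * (\<Prod>j\<leftarrow>js. x j)))" ..
  from choice[OF this] obtain x where x: "\<And>k. (\<Sum>i\<in>{1..n}. cmod (x k i)) = 1" "\<And>k i. i \<in> {1..n} \<Longrightarrow> \<mu> k * x k i ^ (m - 1) =
      (\<Sum>js | length js = m - 1 \<and> set js \<subseteq> {1..n}. A (i # js) * (\<Prod>j\<leftarrow>js. x k j))"
    by blast
  \<comment> \<open>Index 0 holds the eigenvalue and the indices from 1 on the eigenvector, so a
    single subsequence serves both.\<close>
  define f where "f i k = (if i = 0 then \<mu> k else x k i)" for i k
  have "bounded (range (f i))" if "i \<in> {0..n}" for i
  proof (cases "i = 0")
    case True
    then show ?thesis using tensor_eigenvalue_bound[OF \<mu>(1)] by (auto simp: f_def bounded_iff)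
  next
    case False
    have "cmod (x k i) \<le> 1" for k
      using member_le_sum[of i "{1..n}" "\<lambda>i. cmod (x k i)"] x(1) that False by auto
    then show ?thesis using False by (auto simp: f_def bounded_iff)
  qed
  then obtain \<phi> l where \<phi>: "strict_mono \<phi>" and lim: "\<And>i. i \<in> {0..n} \<Longrightarrow> (\<lambda>k. f i (\<phi> k)) \<longlonglongrightarrow> l i"
    using finite_common_subsequence[of "{0..n}" f] by blast
  have lim\<mu>: "(\<lambda>k. \<mu> (\<phi> k)) \<longlonglongrightarrow> l 0" using lim[of 0] by (simp add: f_def)
  have limx: "(\<lambda>k. x (\<phi> k) i) \<longlonglongrightarrow> l i" if "i \<in> {1..n}" for i using lim[of i] that by (simp add: f_def)
  have "(\<lambda>k. \<Sum>i\<in>{1..n}. cmod (x (\<phi> k) i)) \<longlonglongrightarrow> (\<Sum>i\<in>{1..n}. cmod (l i))"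
    by (intro tendsto_intros limx)
  then have "(\<Sum>i\<in>{1..n}. cmod (l i)) = 1" unfolding x(1) LIMSEQ_const_iff by simp
  then have "\<exists>i\<in>{1..n}. l i \<noteq> 0" by (metis (no_types, lifting) norm_zero sum.neutral zero_neq_one)
  moreover have "l 0 * l i ^ (m - 1) =
      (\<Sum>js | length js = m - 1 \<and> set js \<subseteq> {1..n}. A (i # js) * (\<Prod>j\<leftarrow>js. l j))" if i: "i \<in> {1..n}" for i
  proof (rule LIMSEQ_unique)
    show "(\<lambda>k. \<mu> (\<phi> k) * x (\<phi> k) i ^ (m - 1)) \<longlonglongrightarrow> l 0 * l i ^ (m - 1)"
      by (intro tendsto_intros lim\<mu> limx i)
    show "(\<lambda>k. \<mu> (\<phi> k) * x (\<phi> k) i ^ (m - 1)) \<longlonglongrightarrow>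
      (\<Sum>js | length js = m - 1 \<and> set js \<subseteq> {1..n}. A (i # js) * (\<Prod>j\<leftarrow>js. l j))"
      unfolding x(2)[OF i] by (intro tendsto_intros tendsto_prod_list limx) auto
  qed
  ultimately have "tensor_eigenvalue m n A (l 0)" unfolding tensor_eigenvalue_def by blast
  moreover have "cmod \<nu> \<le> cmod (l 0)" if "tensor_eigenvalue m n A \<nu>" for \<nu>
  proof -
    have "(\<lambda>k. Sup E - 1 / real (Suc k)) \<longlonglongrightarrow> Sup E - 0"
      using LIMSEQ_inverse_real_of_nat by (intro tendsto_intros) (simp add: inverse_eq_divide)
    from LIMSEQ_subseq_LIMSEQ[OF this \<phi>]
    have "(\<lambda>k. Sup E - 1 / real (Suc (\<phi> k))) \<longlonglongrightarrow> Sup E - 0" unfolding o_def .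
    then have "Sup E - 0 \<le> cmod (l 0)"
      using \<mu>(2)[THEN less_imp_le] by (intro LIMSEQ_le[OF _ tendsto_norm[OF lim\<mu>]]) auto
    moreover have "cmod \<nu> \<le> Sup E" using that E(2) by (intro cSup_upper) (auto simp: E_def)
    ultimately show ?thesis by simp
  qed
  ultimately show ?thesis by blast
qed

text \<open>A tensor of order 2 is a square matrix, for which a complex eigenvalue exists. Indices
  shift by one between vectors counted from 0 and tensors counted from 1.\<close>

lemma matrix_eigenvalue_exists:
  assumes "n > 0"
  shows "\<exists>\<mu>. tensor_eigenvalue 2 n A \<mu>"
proof -
  define B where "B = mat n n (\<lambda>(i, j). A [Suc i, Suc j])"
  have B: "B \<in> carrier_mat n n" by (simp add: B_def)
  obtain \<mu> where "eigenvalue B \<mu>" using spectrum_non_empty[OF B assms] by (auto simp: spectrum_def)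
  then obtain v where v: "v \<in> carrier_vec n" "v \<noteq> 0\<^sub>v n" "B *\<^sub>v v = \<mu> \<cdot>\<^sub>v v"
    using B by (auto simp: eigenvalue_def eigenvector_def)
  define x where "x i = vec_index v (i - 1)" for i
  have "\<exists>i\<in>{1..n}. x i \<noteq> 0"
  proof -
    obtain i where "i < n" "vec_index v i \<noteq> 0" using v(1,2) by (metis carrier_vecD eq_vecI index_zero_vec)
    then show ?thesis by (intro bexI[of _ "Suc i"]) (auto simp: x_def)
  qed
  moreover have "\<mu> * x i ^ (2 - 1) = (\<Sum>js | length js = 2 - 1 \<and> set js \<subseteq> {1..n}. A (i # js) * (\<Prod>j\<leftarrow>js. x j))"
    if i: "i \<in> {1..n}" for i
  proof -
    have "i - 1 < dim_vec v" using v(1) i by auto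
    then have "\<mu> * x i = vec_index (B *\<^sub>v v) (i - 1)" by (simp add: v(3) x_def)
    also have "\<dots> = (\<Sum>j\<in>{0..<n}. A [i, Suc j] * vec_index v j)"
      using \<open>i - 1 < dim_vec v\<close> v(1) i by (simp add: B_def scalar_prod_def)
    also have "\<dots> = (\<Sum>j\<in>{1..n}. A [i, j] * x j)"
      by (rule sum.reindex_bij_witness[where j = Suc and i = "\<lambda>j. j - 1"]) (auto simp: x_def)
    also have "\<dots> = (\<Sum>js | length js = Suc 0 \<and> set js \<subseteq> {1..n}. A (i # js) * (\<Prod>j\<leftarrow>js. x j))"
    proof -
      have "{js. length js = 0 \<and> set js \<subseteq> {1..n}} = {[]}" by auto
      then show ?thesis by (subst sum_lists_Suc) (simp, simp only:, simp)
    qed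
    finally show ?thesis by simp
  qed
  ultimately show ?thesis unfolding tensor_eigenvalue_def by blast
qed

text \<open>Without an eigenvalue, \<open>GREATEST\<close> in the definition of the spectral radius would be unspecified.\<close>

lemma clique_tensor_eigenvalue_exists:
  assumes "n > 0" "t \<ge> 2"
  shows "\<exists>\<mu>. tensor_eigenvalue t n (clique_tensor t G) \<mu>"
proof (cases "t = 2")
  case True
  then show ?thesis using matrix_eigenvalue_exists[OF assms(1)] by simp
next
  case False
  \<comment> \<open>For \<open>t \<ge> 3\<close> the first unit vector is an eigenvector for 0: a
    nonzero product forces all of \<open>js\<close> to be 1, and then \<open>i # js\<close> has at
    most two distinct entries, too few for a \<open>t\<close>-clique.\<close>
  have "tensor_eigenvalue t n (clique_tensor t G) 0"
    unfolding tensor_eigenvalue_def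
  proof (intro exI[of _ "\<lambda>i. if i = 1 then 1 else 0"] conjI ballI)
    show "\<exists>i\<in>{1..n}. (if i = 1 then 1 else 0) \<noteq> (0::complex)" using assms by auto
    fix i assume "i \<in> {1..n}"
    have "clique_tensor t G (i # js) * (\<Prod>j\<leftarrow>js. if j = 1 then 1 else 0) = 0" if "length js = t - 1" for js
    proof (cases "set js \<subseteq> {1}")
      case True
      then have "card (set (i # js)) \<le> card {i, 1}" by (intro card_mono) auto
      also have "\<dots> \<le> 2" by (simp add: card_insert_if)
      finally have "set (i # js) \<notin> cliques t G" using False assms(2) cliquesD(3) by fastforce
      then show ?thesis by (simp add: clique_tensor_def)
    next
      case False
      then show ?thesis by (auto simp: prod_list_zero_iff)
    qed
    then show "0 * (if i = 1 then 1 else 0) ^ (t - 1) = (\<Sum>js | length js = t - 1 \<and> set js \<subseteq> {1..n}.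
        clique_tensor t G (i # js) * (\<Prod>j\<leftarrow>js. if j = 1 then 1 else 0))"
      by (simp add: sum.neutral)
  qed
  then show ?thesis by blast
qed

lemma clique_spectral_radius_eigenvalue:
  assumes "verts G = {1..n}" "n > 0" "t \<ge> 2"
  obtains \<mu> where "tensor_eigenvalue t n (clique_tensor t G) \<mu>" "clique_spectral_radius t G = cmod \<mu>"
proof -
  obtain \<mu> where \<mu>: "tensor_eigenvalue t n (clique_tensor t G) \<mu>"
    "\<And>\<nu>. tensor_eigenvalue t n (clique_tensor t G) \<nu> \<Longrightarrow> cmod \<nu> \<le> cmod \<mu>"
    using clique_tensor_eigenvalue_exists[OF assms(2,3)] max_tensor_eigenvalue by metis
  have "clique_spectral_radius t G = cmod \<mu>"
    unfolding clique_spectral_radius_def using \<mu> assms(1) by (intro Greatest_equality) auto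
  then show thesis using \<mu> that by blast
qed

text \<open>A \<open>t\<close>-clique is the set of exactly \<open>fact t\<close> lists of length
  \<open>t\<close>, namely its permutations, since a list of that length covering it has no
  repetition.\<close>

lemma sum_lists_cliques:
  fixes y :: "nat \<Rightarrow> real"
  assumes "simple_graph G" "verts G = {1..n}"
  shows "(\<Sum>js | length js = t \<and> set js \<subseteq> {1..n}. (if set js \<in> cliques t G then \<Prod>j\<leftarrow>js. y j else 0)) =
    fact t * clique_weight G y t"
proof -
  let ?L = "{js. length js = t \<and> set js \<in> cliques t G}"
  have finL: "finite {js. length js = t \<and> set js \<subseteq> {1..n}}"
    using finite_lists_length_eq[of "{1..n}" t] by (simp add: conj_commute)
  have sub: "S \<subseteq> {1..n}" if "S \<in> cliques t G" for S using cliquesD(1)[OF that] assms(2) by simp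
  have L: "?L = {js. length js = t \<and> set js \<subseteq> {1..n}} \<inter> {js. set js \<in> cliques t G}" using sub by auto
  have "(\<Sum>js | length js = t \<and> set js \<subseteq> {1..n}. (if set js \<in> cliques t G then \<Prod>j\<leftarrow>js. y j else 0)) =
      (\<Sum>js\<in>?L. \<Prod>j\<leftarrow>js. y j)"
    unfolding L using finL by (simp add: sum.If_cases)
  also have "\<dots> = (\<Sum>S\<in>cliques t G. \<Sum>js | js \<in> ?L \<and> set js = S. \<Prod>j\<leftarrow>js. y j)"
    using finL finite_cliques[OF assms(1)] by (intro sum.group[symmetric]) (auto simp: L)
  also have "\<dots> = (\<Sum>S\<in>cliques t G. fact t * (\<Prod>v\<in>S. y v))"
  proof (rule sum.cong[OF refl])
    fix S assume S: "S \<in> cliques t G"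
    have eq: "{js. js \<in> ?L \<and> set js = S} = permutations_of_set S"
    proof (rule Set.set_eqI)
      fix js
      have "length js = t \<longleftrightarrow> distinct js" if "set js = S"
        using that cliquesD(3)[OF S] card_distinct[of js] distinct_card[of js] by metis
      then show "js \<in> {js. js \<in> ?L \<and> set js = S} \<longleftrightarrow> js \<in> permutations_of_set S"
        using S unfolding permutations_of_set_def mem_Collect_eq by metis
    qed
    have "(\<Sum>js\<in>permutations_of_set S. \<Prod>j\<leftarrow>js. y j) = (\<Sum>js\<in>permutations_of_set S. \<Prod>v\<in>S. y v)"
      by (rule sum.cong[OF refl]) (auto simp: permutations_of_set_def prod.distinct_set_conv_list)
    then show "(\<Sum>js | js \<in> ?L \<and> set js = S. \<Prod>j\<leftarrow>js. y j) = fact t * (\<Prod>v\<in>S. y v)"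
      unfolding eq using cliquesD[OF S] by simp
  qed
  finally show ?thesis by (simp add: clique_weight_def sum_distrib_left)
qed

text \<open>Collects what the density argument uses of the spectral radius. The power bound is the
  inequality at a coordinate equal to 1, with all tensor entries bounded by 1; the clique bound
  multiplies the inequality at \<open>v\<close> by \<open>y v\<close> and sums, where
  \<open>fact t / fact (t - 1)\<close> leaves the factor \<open>t\<close>.\<close>

lemma clique_spectral_radius_vector:
  assumes G: "simple_graph G" "verts G = {1..n}" and "n > 0" "t \<ge> 2"
  obtains y where "\<And>v. 0 \<le> y v \<and> y v \<le> 1" "clique_spectral_radius t G \<le> (\<Sum>v\<in>verts G. y v) ^ (t - 1)"
    "clique_spectral_radius t G * (\<Sum>v\<in>verts G. y v ^ t) \<le> real t * clique_weight G y t" "sum y (verts G) > 0"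
proof -
  let ?\<rho> = "clique_spectral_radius t G"
  obtain \<mu> where \<mu>: "tensor_eigenvalue t n (clique_tensor t G) \<mu>" "?\<rho> = cmod \<mu>"
    using clique_spectral_radius_eigenvalue[OF G(2) assms(3,4)] .
  obtain i0 y where y: "i0 \<in> {1..n}" "y i0 = 1" "\<And>i. 0 \<le> y i \<and> y i \<le> 1"
    "\<And>i. i \<in> {1..n} \<Longrightarrow> cmod \<mu> * y i ^ (t - 1) \<le>
      (\<Sum>js | length js = t - 1 \<and> set js \<subseteq> {1..n}. cmod (clique_tensor t G (i # js)) * (\<Prod>j\<leftarrow>js. y j))"
    by (rule tensor_eigenvalue_modulus[OF \<mu>(1)]) (rule that)
  note y = y(1-3) y(4)[folded \<mu>(2)]
  have nn: "0 \<le> (\<Prod>j\<leftarrow>js. y j)" for js using prod_list_le_power[of js y 1] y(3) by auto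
  have "?\<rho> \<le> (\<Sum>js | length js = t - 1 \<and> set js \<subseteq> {1..n}. cmod (clique_tensor t G (i0 # js)) * (\<Prod>j\<leftarrow>js. y j))"
    using y(4)[OF y(1)] y(2) by simp
  also have "\<dots> \<le> (\<Sum>js | length js = t - 1 \<and> set js \<subseteq> {1..n}. 1 * (\<Prod>j\<leftarrow>js. y j))"
    by (intro sum_mono mult_right_mono nn) (simp add: clique_tensor_def norm_divide)
  also have "\<dots> = (\<Sum>v\<in>verts G. y v) ^ (t - 1)"
    using sum_lists_prod[where V = "{1..n}" and q = "t - 1" and x = y] G(2) by simp
  finally have 1: "?\<rho> \<le> (\<Sum>v\<in>verts G. y v) ^ (t - 1)" .
  have t: "t = Suc (t - 1)" using assms(4) by simp
  have "?\<rho> * (\<Sum>v\<in>verts G. y v ^ t) = (\<Sum>v\<in>{1..n}. y v * (?\<rho> * y v ^ (t - 1)))"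
    unfolding sum_distrib_left G(2) by (subst t) (simp only: power_Suc mult_ac)
  also have "\<dots> \<le> (\<Sum>v\<in>{1..n}. y v *
      (\<Sum>js | length js = t - 1 \<and> set js \<subseteq> {1..n}. cmod (clique_tensor t G (v # js)) * (\<Prod>j\<leftarrow>js. y j)))"
    using y by (intro sum_mono mult_left_mono) auto
  also have "\<dots> = (\<Sum>v\<in>{1..n}. \<Sum>js | length js = t - 1 \<and> set js \<subseteq> {1..n}.
      (1 / fact (t - 1)) * (if set (v # js) \<in> cliques t G then \<Prod>j\<leftarrow>(v # js). y j else 0))"
    unfolding sum_distrib_left by (intro sum.cong refl) (simp add: clique_tensor_def norm_divide)
  also have "\<dots> = (\<Sum>js | length js = t \<and> set js \<subseteq> {1..n}.
      (1 / fact (t - 1)) * (if set js \<in> cliques t G then \<Prod>j\<leftarrow>js. y j else 0))"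
    using sum_lists_Suc[where V = "{1..n}" and q = "t - 1" and
      g = "\<lambda>js. (1 / fact (t - 1)) * (if set js \<in> cliques t G then \<Prod>j\<leftarrow>js. y j else 0)"]
    by (simp only: finite_atLeastAtMost t[symmetric])
  also have "\<dots> = (1 / fact (t - 1)) * (fact t * clique_weight G y t)"
    unfolding sum_distrib_left[symmetric] sum_lists_cliques[OF G] ..
  also have "\<dots> = real t * clique_weight G y t"
    using fact_reduce[of t, where 'a = real] assms(4) by simp
  finally have 2: "?\<rho> * (\<Sum>v\<in>verts G. y v ^ t) \<le> real t * clique_weight G y t" .
  have "sum y (verts G) > 0"
    using y(1-3) G(2) by (intro sum_pos2[of _ i0]) auto
  then show thesis using that[of y] y(3) 1 2 by blast
qed

section \<open>Clique densities from the spectral radius\<close>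

lemma clique_weight_le_power:
  assumes "simple_graph G" and w: "\<And>v. w v \<ge> 0"
  shows "clique_weight G w s \<le> sum w (verts G) ^ s"
proof (induction s)
  case 0
  show ?case by (simp add: clique_weight_0)
next
  case (Suc s)
  have cod: "codegree G w J \<le> sum w (verts G)" for J
    unfolding codegree_def using assms by (intro sum_mono2) (auto simp: simple_graph_def common_nbrs_def)
  have "clique_weight G w (Suc s) \<le> real (Suc s) * clique_weight G w (Suc s)"
    using mult_right_mono[of 1 "real (Suc s)" "clique_weight G w (Suc s)"] clique_weight_nonneg[of w G, OF w] by simp
  also have "\<dots> = (\<Sum>J\<in>cliques s G. (\<Prod>v\<in>J. w v) * codegree G w J)"
    by (rule sum_codegree_clique[OF assms(1), symmetric])
  also have "\<dots> \<le> (\<Sum>J\<in>cliques s G. (\<Prod>v\<in>J. w v) * sum w (verts G))"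
    using w by (intro sum_mono mult_left_mono cod prod_nonneg) auto
  also have "\<dots> = clique_weight G w s * sum w (verts G)"
    by (simp add: clique_weight_def sum_distrib_right)
  also have "\<dots> \<le> sum w (verts G) ^ s * sum w (verts G)"
    using Suc.IH w by (intro mult_right_mono sum_nonneg) auto
  finally show ?case by (simp add: mult.commute)
qed

text \<open>Both sides of the Moon--Moser inequality are homogeneous of degree
  \<open>2 * s + 2\<close> in the weights, so division by powers of the total weight preserves
  it.\<close>

lemma moon_moser_sequence_clique_weight:
  assumes G: "simple_graph G" and w: "\<And>v. w v \<ge> 0" and pos: "sum w (verts G) > 0"
  shows "moon_moser_sequence r (\<lambda>s. clique_weight G w s / sum w (verts G) ^ s)"
proof -
  define W where "W = sum w (verts G)"
  have W: "W > 0" using pos by (simp add: W_def)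
  have "(real (Suc s))\<^sup>2 * (clique_weight G w (Suc s) / W ^ Suc s)\<^sup>2 \<le>
      clique_weight G w s / W ^ s * (clique_weight G w (Suc s) / W ^ Suc s +
        ((real (Suc s))\<^sup>2 - 1) * (clique_weight G w (Suc (Suc s)) / W ^ Suc (Suc s)))" (is "?l \<le> ?r") for s
  proof -
    let ?c = "clique_weight G w"
    have "?l = (real (Suc s))\<^sup>2 * (?c (Suc s))\<^sup>2 / (W ^ Suc s)\<^sup>2"
      by (simp add: power_divide)
    also have "\<dots> \<le> ?c s * (W * ?c (Suc s) + ((real (Suc s))\<^sup>2 - 1) * ?c (Suc (Suc s))) / (W ^ Suc s)\<^sup>2"
      using moon_moser[of G w s, OF G w] by (intro divide_right_mono) (auto simp: W_def)
    also have "\<dots> = ?r"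
      using W by (simp add: field_simps power2_eq_square)
    finally show ?thesis .
  qed
  moreover have "0 \<le> clique_weight G w s / W ^ s \<and> clique_weight G w s / W ^ s \<le> 1" for s
    using clique_weight_le_power[of G w s, OF G w] clique_weight_nonneg[of w G s, OF w] W by (simp add: W_def)
  moreover have "clique_weight G w (Suc 0) / W ^ Suc 0 = 1"
    using W by (simp add: clique_weight_1 W_def)
  ultimately show ?thesis
    unfolding moon_moser_sequence_def W_def[symmetric] by (simp only: clique_weight_0 power_0 div_by_1 simp_thms)
qed

text \<open>Bernoulli's inequality with a quadratic gain, an identity for \<open>t = 2\<close>. The
  gain is what makes the power mean inequality stable.\<close>

lemma bernoulli_quadratic:
  fixes z :: real
  assumes "z \<ge> 0" "t \<ge> 2"
  shows "1 + real t * (z - 1) + (z - 1)\<^sup>2 \<le> z ^ t"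
  using assms(2)
proof (induction t rule: nat_induct_at_least)
  case base
  show ?case by (simp add: power2_eq_square algebra_simps)
next
  case (Suc t)
  have "0 \<le> (real t - 1 + z) * (z - 1)\<^sup>2"
    using Suc.hyps assms(1) by (intro mult_nonneg_nonneg) auto
  then have "1 + real (Suc t) * (z - 1) + (z - 1)\<^sup>2 \<le> z * (1 + real t * (z - 1) + (z - 1)\<^sup>2)"
    by (simp add: power2_eq_square algebra_simps)
  also have "\<dots> \<le> z * z ^ t" using Suc.IH assms(1) by (rule mult_left_mono)
  finally show ?case by simp
qed

text \<open>After division by the mean the linear terms cancel in the sum, so the excess of the
  \<open>t\<close>-th moment bounds the variance. Cauchy--Schwarz passes to the sum of absolute
  deviations, hence \<open>\<kappa>^2\<close> in the hypothesis and \<open>\<kappa>\<close> in the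
  conclusion.\<close>

lemma power_mean_stability:
  fixes y :: "'b \<Rightarrow> real"
  assumes fin: "finite V" and n: "n = card V" and y: "\<And>v. y v \<ge> 0" and t: "t \<ge> 2"
    and a: "sum y V = real n * a" "a > 0"
  shows "real n * a ^ t \<le> (\<Sum>v\<in>V. y v ^ t)"
    "(\<Sum>v\<in>V. y v ^ t) \<le> (1 + \<kappa>\<^sup>2) * (real n * a ^ t) \<Longrightarrow> \<kappa> \<ge> 0 \<Longrightarrow> (\<Sum>v\<in>V. \<bar>y v - a\<bar>) \<le> \<kappa> * real n * a"
proof -
  define z where "z v = y v / a" for v
  have sum_z: "(\<Sum>v\<in>V. z v - 1) = 0"
    using a by (simp add: z_def sum_subtractf sum_divide_distrib[symmetric] n)
  have "(\<Sum>v\<in>V. 1 + real t * (z v - 1) + (z v - 1)\<^sup>2) \<le> (\<Sum>v\<in>V. z v ^ t)"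
    using y a(2) by (intro sum_mono bernoulli_quadratic t) (simp add: z_def)
  then have key: "real n + (\<Sum>v\<in>V. (z v - 1)\<^sup>2) \<le> (\<Sum>v\<in>V. z v ^ t)"
    using sum_z by (simp add: sum.distrib sum_distrib_left[symmetric] n)
  have zt: "(\<Sum>v\<in>V. z v ^ t) = (\<Sum>v\<in>V. y v ^ t) / a ^ t"
    by (simp add: z_def power_divide sum_divide_distrib)
  have at: "a ^ t > 0" using a(2) by simp
  have "0 \<le> (\<Sum>v\<in>V. (z v - 1)\<^sup>2)" by (intro sum_nonneg) simp
  then have "real n \<le> (\<Sum>v\<in>V. y v ^ t) / a ^ t" using key zt by linarith
  then show "real n * a ^ t \<le> (\<Sum>v\<in>V. y v ^ t)" using at by (simp add: pos_le_divide_eq)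
  assume le: "(\<Sum>v\<in>V. y v ^ t) \<le> (1 + \<kappa>\<^sup>2) * (real n * a ^ t)" and \<kappa>: "\<kappa> \<ge> 0"
  have "(\<Sum>v\<in>V. z v ^ t) \<le> (1 + \<kappa>\<^sup>2) * real n"
    unfolding zt using le at by (simp add: pos_divide_le_eq mult_ac)
  then have sq: "(\<Sum>v\<in>V. (z v - 1)\<^sup>2) \<le> \<kappa>\<^sup>2 * real n" using key by (simp add: algebra_simps)
  have "(\<Sum>v\<in>V. \<bar>z v - 1\<bar> * 1)\<^sup>2 \<le> (\<Sum>v\<in>V. \<bar>z v - 1\<bar>\<^sup>2) * (\<Sum>v\<in>V. 1\<^sup>2)"
    by (rule Cauchy_Schwarz_ineq_sum)
  also have "\<dots> \<le> (\<kappa>\<^sup>2 * real n) * real n"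
    using sq by (simp add: n mult_right_mono)
  also have "\<dots> = (\<kappa> * real n)\<^sup>2" by (simp add: power2_eq_square)
  finally have "(\<Sum>v\<in>V. \<bar>z v - 1\<bar>) \<le> \<kappa> * real n"
    using \<kappa> by (simp add: power2_le_iff_abs_le abs_of_nonneg sum_nonneg)
  moreover have "\<bar>y v - a\<bar> = a * \<bar>z v - 1\<bar>" for v
  proof -
    have "y v - a = a * (z v - 1)" using a(2) by (simp add: z_def field_simps)
    then show ?thesis using a(2) by (simp add: abs_mult)
  qed
  ultimately show "(\<Sum>v\<in>V. \<bar>y v - a\<bar>) \<le> \<kappa> * real n * a"
    using a(2) by (simp add: sum_distrib_left[symmetric] mult.commute mult_left_mono)
qed

text \<open>A product of numbers in the unit interval changes by at most the sum of the changes of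
  its factors, and a vertex extends at most \<open>n ^ s\<close> cliques of size
  \<open>s\<close>.\<close>

lemma clique_weight_perturb:
  fixes y :: "'a \<Rightarrow> real"
  assumes G: "simple_graph G" and n: "n = card (verts G)" and y: "\<And>v. 0 \<le> y v \<and> y v \<le> 1" and a: "0 \<le> a" "a \<le> 1"
  shows "clique_weight G y (Suc s) \<le> real (card (cliques (Suc s) G)) * a ^ Suc s + real n ^ s * (\<Sum>v\<in>verts G. \<bar>y v - a\<bar>)"
proof -
  have fin: "finite (verts G)" using G by (simp add: simple_graph_def)
  have pt: "(\<Prod>v\<in>S. y v) \<le> a ^ Suc s + (\<Sum>v\<in>S. \<bar>y v - a\<bar>)" if S: "S \<in> cliques (Suc s) G" for S
  proof -
    have "norm ((\<Prod>v\<in>S. y v) - (\<Prod>v\<in>S. a)) \<le> (\<Sum>v\<in>S. norm (y v - a))"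
      by (rule norm_prod_diff) (use y a in auto)
    then show ?thesis using cliquesD(3)[OF S] by simp
  qed
  have "clique_weight G y (Suc s) \<le> (\<Sum>S\<in>cliques (Suc s) G. a ^ Suc s + (\<Sum>v\<in>S. \<bar>y v - a\<bar>))"
    unfolding clique_weight_def by (intro sum_mono pt)
  also have "\<dots> = real (card (cliques (Suc s) G)) * a ^ Suc s + (\<Sum>S\<in>cliques (Suc s) G. \<Sum>v\<in>S. \<bar>y v - a\<bar>)"
    by (simp add: sum.distrib)
  also have "(\<Sum>S\<in>cliques (Suc s) G. \<Sum>v\<in>S. \<bar>y v - a\<bar>) = (\<Sum>J\<in>cliques s G. \<Sum>v\<in>common_nbrs G J. \<bar>y v - a\<bar>)"
    by (rule sum_clique_remove[OF G])
  also have "\<dots> \<le> (\<Sum>J\<in>cliques s G. \<Sum>v\<in>verts G. \<bar>y v - a\<bar>)"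
    using fin by (intro sum_mono sum_mono2) (auto simp: common_nbrs_def)
  also have "\<dots> = real (card (cliques s G)) * (\<Sum>v\<in>verts G. \<bar>y v - a\<bar>)" by simp
  also have "\<dots> \<le> real n ^ s * (\<Sum>v\<in>verts G. \<bar>y v - a\<bar>)"
    using clique_weight_le_power[of G "\<lambda>_. 1" s, OF G] by (intro mult_right_mono sum_nonneg) (auto simp: n clique_weight_def)
  finally show ?thesis by simp
qed

text \<open>Explains the threshold: a constant vector in the clique bound suggests
  \<open>\<rho>\<close> close to \<open>t\<close> times the number of \<open>t\<close>-cliques
  divided by \<open>n\<close>.\<close>

lemma turan_density_spectral:
  assumes "2 \<le> t" "t \<le> r"
  shows "real ((r - 1) choose (t - 1)) * (1 / real r) ^ (t - 1) = real t * turan_density r t"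
proof -
  obtain u where t: "t = Suc u" using assms by (cases t) auto
  have r: "r > 0" using assms by simp
  have "real (Suc u) * real (r choose Suc u) = real r * real ((r - 1) choose u)"
    by (metis binomial_absorption of_nat_mult)
  then show ?thesis using r by (simp add: turan_density_def t power_one_over field_simps)
qed

text \<open>Weighted stability bounds the clique weight from above, the spectral radius bounds it
  from below by a multiple of the \<open>t\<close>-th moment of \<open>y\<close>. Together they
  force \<open>y\<close> to be nearly constant, the plain \<open>t\<close>-clique density is then
  large, and stability for constant weights gives all densities.\<close>

lemma clique_density_from_spectral_radius:
  assumes t: "2 \<le> t" "t \<le> r" and "\<epsilon> > 0"
  shows "\<exists>\<delta>>0. \<forall>n>0. \<forall>G. simple_graph G \<and> verts G = {1..n} \<and>
      real (card (cliques (Suc r) G)) \<le> \<delta> * real n ^ Suc r \<and>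
      clique_spectral_radius t G \<ge> (real t * turan_density r t - \<delta>) * real n ^ (t - 1) \<longrightarrow>
    (\<forall>s\<le>r. \<bar>real (card (cliques s G)) / real n ^ s - turan_density r s\<bar> \<le> \<epsilon>)"
proof -
  define \<tau> where "\<tau> = turan_density r t"
  have \<tau>: "\<tau> > 0" using t by (auto simp: \<tau>_def intro: turan_density_pos)
  \<comment> \<open>A lower bound for the mean \<open>a\<close> of \<open>y\<close>: since
    \<open>a \<le> 1\<close>, also
    \<open>a \<ge> a ^ (t - 1) \<ge> t * \<tau> - \<delta> \<ge> c\<close>.\<close>
  define c where "c = real t * \<tau> / 2"
  have c: "c > 0" using \<tau> t by (simp add: c_def)
  obtain \<delta>1 where \<delta>1: "\<delta>1 > 0" "\<And>d. moon_moser_sequence r d \<Longrightarrow> d (Suc r) \<le> \<delta>1 \<Longrightarrow> d t \<ge> \<tau> - \<delta>1 \<Longrightarrow>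
      \<forall>s\<le>r. \<bar>d s - turan_density r s\<bar> \<le> \<epsilon>"
    using clique_density_stability[OF t \<open>\<epsilon> > 0\<close>] unfolding \<tau>_def by blast
  \<comment> \<open>The deviation allowed for \<open>y\<close>, small enough that replacing
    \<open>y\<close> by \<open>a\<close> costs at most \<open>\<delta>1 / 2\<close> in the density
    of \<open>t\<close>-cliques.\<close>
  define \<kappa> where "\<kappa> = \<delta>1 * c ^ t / 2"
  have \<kappa>: "\<kappa> > 0" using \<delta>1 c by (simp add: \<kappa>_def)
  define \<epsilon>' where "\<epsilon>' = \<kappa>\<^sup>2 * \<tau> / 2"
  have "\<epsilon>' > 0" using \<kappa> \<tau> by (simp add: \<epsilon>'_def)
  then obtain \<delta>2 where \<delta>2: "\<delta>2 > 0" "\<And>d. moon_moser_sequence r d \<Longrightarrow> d (Suc r) \<le> \<delta>2 \<Longrightarrow> d t \<ge> \<tau> - \<delta>2 \<Longrightarrow>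
      \<forall>s\<le>r. \<bar>d s - turan_density r s\<bar> \<le> \<epsilon>'"
    using clique_density_stability[OF t] unfolding \<tau>_def by blast
  \<comment> \<open>The factor \<open>c ^ Suc r\<close> pays for measuring
    \<open>(r + 1)\<close>-cliques against the total weight instead of \<open>n\<close>. The
    fraction in \<open>\<kappa>\<close> gives \<open>\<tau> + \<epsilon>' \<le> (1 + \<kappa>^2) *
    (\<tau> - \<delta>)\<close>, and \<open>\<tau> / 2\<close> keeps
    \<open>\<tau> - \<delta>\<close> positive for cancellation.\<close>
  define \<delta> where "\<delta> = Min {\<delta>1 / 2, \<delta>2, \<delta>2 * c ^ Suc r, \<kappa>\<^sup>2 * \<tau> / (2 * (1 + \<kappa>\<^sup>2)), c, \<tau> / 2}"
  have \<kappa>1: "1 + \<kappa>\<^sup>2 > 0" by (simp add: add_pos_nonneg)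
  have \<delta>: "\<delta> > 0" using \<delta>1 \<delta>2 c \<kappa> \<tau> \<kappa>1 by (auto simp: \<delta>_def)
  have \<delta>_le: "\<delta> \<le> \<delta>1 / 2" "\<delta> \<le> \<delta>2" "\<delta> \<le> \<delta>2 * c ^ Suc r" "\<delta> \<le> \<kappa>\<^sup>2 * \<tau> / (2 * (1 + \<kappa>\<^sup>2))" "\<delta> \<le> c" "\<delta> \<le> \<tau> / 2"
    unfolding \<delta>_def by (intro Min_le; simp)+
  have \<delta>\<kappa>: "\<tau> + \<epsilon>' \<le> (1 + \<kappa>\<^sup>2) * (\<tau> - \<delta>)"
  proof -
    have "(1 + \<kappa>\<^sup>2) * \<delta> \<le> (1 + \<kappa>\<^sup>2) * (\<kappa>\<^sup>2 * \<tau> / (2 * (1 + \<kappa>\<^sup>2)))"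
      using \<delta>_le(4) \<kappa>1 by (intro mult_left_mono) auto
    also have "\<dots> = \<kappa>\<^sup>2 * \<tau> / 2" using \<kappa>1 by (simp add: field_simps)
    finally show ?thesis by (simp add: \<epsilon>'_def algebra_simps)
  qed
  have "\<forall>s\<le>r. \<bar>real (card (cliques s G)) / real n ^ s - turan_density r s\<bar> \<le> \<epsilon>"
    if n: "n > 0" and G: "simple_graph G" "verts G = {1..n}"
      and few: "real (card (cliques (Suc r) G)) \<le> \<delta> * real n ^ Suc r"
      and spec: "clique_spectral_radius t G \<ge> (real t * \<tau> - \<delta>) * real n ^ (t - 1)" for n G
  proof -
    let ?\<rho> = "clique_spectral_radius t G"
    obtain u where u: "t = Suc u" "u \<ge> 1" using t by (cases t) auto
    have N: "real n > 0" using n by simp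
    have cV: "n = card (verts G)" and finV: "finite (verts G)" using G by auto
    obtain y where y: "\<And>v. 0 \<le> y v \<and> y v \<le> 1" "?\<rho> \<le> (\<Sum>v\<in>verts G. y v) ^ (t - 1)"
      "?\<rho> * (\<Sum>v\<in>verts G. y v ^ t) \<le> real t * clique_weight G y t" "sum y (verts G) > 0"
      using clique_spectral_radius_vector[OF G n t(1)] by blast
    have y0: "\<And>v. y v \<ge> 0" using y(1) by blast
    define a where "a = sum y (verts G) / real n"
    have na: "sum y (verts G) = real n * a" using N by (simp add: a_def)
    have "sum y (verts G) \<le> (\<Sum>v\<in>verts G. 1)" using y(1) by (intro sum_mono) blast
    then have a1: "a \<le> 1" using N by (simp add: a_def cV[symmetric])
    have a0: "a > 0" using y(4) N by (simp add: a_def)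
    have "c * real n ^ u \<le> (real t * \<tau> - \<delta>) * real n ^ u"
      using \<delta>_le(5) by (intro mult_right_mono) (auto simp: c_def mult.commute)
    also have "\<dots> \<le> (real n * a) ^ u" using spec y(2) by (simp add: na u)
    also have "\<dots> = a ^ u * real n ^ u" by (simp add: power_mult_distrib mult.commute)
    also have "\<dots> \<le> a * real n ^ u"
      using a0 a1 u(2) power_decreasing[of 1 u a] by (intro mult_right_mono) auto
    finally have ac: "c \<le> a" using N by simp
    define P where "P = (\<Sum>v\<in>verts G. y v ^ t)"
    have mean: "real n * a ^ t \<le> P"
      "P \<le> (1 + \<kappa>\<^sup>2) * (real n * a ^ t) \<Longrightarrow> \<kappa> \<ge> 0 \<Longrightarrow> (\<Sum>v\<in>verts G. \<bar>y v - a\<bar>) \<le> \<kappa> * real n * a"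
      using power_mean_stability[OF finV cV y0 t(1) na a0] by (auto simp: P_def)
    have P0: "P \<ge> 0" unfolding P_def using y0 by (intro sum_nonneg) simp
    have cwP: "(\<tau> - \<delta>) * real n ^ u * P \<le> clique_weight G y t"
    proof -
      have "real t * ((\<tau> - \<delta>) * real n ^ u * P) \<le> (real t * \<tau> - \<delta>) * real n ^ u * P"
      proof -
        have "\<delta> \<le> real t * \<delta>" using \<delta> t by simp
        then have "real t * (\<tau> - \<delta>) \<le> real t * \<tau> - \<delta>" by (simp add: right_diff_distrib)
        then have "real t * (\<tau> - \<delta>) * (real n ^ u * P) \<le> (real t * \<tau> - \<delta>) * (real n ^ u * P)"
          using P0 by (intro mult_right_mono) auto
        then show ?thesis by (simp only: mult.assoc)
      qed
      also have "\<dots> \<le> ?\<rho> * P" using spec P0 by (intro mult_right_mono) (auto simp: u)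
      also have "\<dots> \<le> real t * clique_weight G y t" using y(3) by (simp add: P_def)
      finally show ?thesis using t by simp
    qed
    have nat_pow: "real n ^ u * (real n * a ^ t) = (real n * a) ^ t" by (simp add: u power_mult_distrib)
    have lower: "(\<tau> - \<delta>) * (real n * a) ^ t \<le> clique_weight G y t"
    proof -
      have "(\<tau> - \<delta>) * (real n ^ u * (real n * a ^ t)) \<le> (\<tau> - \<delta>) * (real n ^ u * P)"
        using \<delta>_le(6) \<tau> mean(1) by (intro mult_left_mono) auto
      then show ?thesis using cwP unfolding nat_pow by (simp add: mult.assoc)
    qed
    have na_pos: "(real n * a) ^ s > 0" for s using N a0 by simp
    define d where "d s = clique_weight G y s / sum y (verts G) ^ s" for s
    have "\<forall>s\<le>r. \<bar>d s - turan_density r s\<bar> \<le> \<epsilon>'"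
    proof (rule \<delta>2(2))
      show "moon_moser_sequence r d"
        unfolding d_def by (rule moon_moser_sequence_clique_weight[OF G(1) y0 y(4)])
      have "clique_weight G y (Suc r) \<le> (\<Sum>S\<in>cliques (Suc r) G. 1)"
        unfolding clique_weight_def using y(1) by (intro sum_mono prod_le_1) auto
      also have "\<dots> \<le> \<delta> * real n ^ Suc r" using few by simp
      also have "\<dots> \<le> \<delta>2 * c ^ Suc r * real n ^ Suc r" using \<delta>_le(3) by (intro mult_right_mono) auto
      also have "\<dots> \<le> \<delta>2 * a ^ Suc r * real n ^ Suc r"
        using ac c \<delta>2(1) by (intro mult_right_mono mult_left_mono power_mono) auto
      also have "\<dots> = \<delta>2 * (real n * a) ^ Suc r" by (simp add: power_mult_distrib)
      finally show "d (Suc r) \<le> \<delta>2" unfolding d_def na using na_pos[of "Suc r"] by (simp add: pos_divide_le_eq)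
      have "(\<tau> - \<delta>2) * (real n * a) ^ t \<le> (\<tau> - \<delta>) * (real n * a) ^ t"
        using \<delta>_le(2) na_pos[of t] by (intro mult_right_mono) auto
      then have "(\<tau> - \<delta>2) * (real n * a) ^ t \<le> clique_weight G y t" using lower by linarith
      then show "d t \<ge> \<tau> - \<delta>2" unfolding d_def na using na_pos[of t] by (simp add: pos_le_divide_eq)
    qed
    then have "d t \<le> \<tau> + \<epsilon>'" using t(2) by (force simp: \<tau>_def)
    then have "clique_weight G y t \<le> (\<tau> + \<epsilon>') * (real n * a) ^ t"
      unfolding d_def na using na_pos[of t] by (simp add: pos_divide_le_eq)
    also have "\<dots> \<le> (1 + \<kappa>\<^sup>2) * (\<tau> - \<delta>) * (real n * a) ^ t"
      using \<delta>\<kappa> na_pos[of t] by (intro mult_right_mono) auto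
    finally have "(\<tau> - \<delta>) * real n ^ u * P \<le> (1 + \<kappa>\<^sup>2) * (\<tau> - \<delta>) * (real n ^ u * (real n * a ^ t))"
      using cwP unfolding nat_pow by linarith
    then have "((\<tau> - \<delta>) * real n ^ u) * P \<le> ((\<tau> - \<delta>) * real n ^ u) * ((1 + \<kappa>\<^sup>2) * (real n * a ^ t))"
      by (simp only: mult_ac)
    then have "P \<le> (1 + \<kappa>\<^sup>2) * (real n * a ^ t)"
      using \<delta>_le(6) \<tau> N by (simp add: mult_le_cancel_left)
    then have L1: "(\<Sum>v\<in>verts G. \<bar>y v - a\<bar>) \<le> \<kappa> * real n * a" using mean(2) \<kappa> by simp
    define k where "k s = real (card (cliques s G)) / real n ^ s" for s
    have "clique_weight G y t \<le> real (card (cliques t G)) * a ^ t + real n ^ u * (\<Sum>v\<in>verts G. \<bar>y v - a\<bar>)"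
      unfolding u(1) using a0 a1 by (intro clique_weight_perturb[OF G(1) cV y(1)]) auto
    also have "\<dots> \<le> real (card (cliques t G)) * a ^ t + real n ^ u * (\<kappa> * real n * a)"
      by (intro add_left_mono mult_left_mono L1) simp
    also have "\<dots> \<le> real (card (cliques t G)) * a ^ t + real n ^ t * \<kappa>"
    proof -
      have "real n ^ t * \<kappa> * a \<le> real n ^ t * \<kappa> * 1" using a1 \<kappa> by (intro mult_left_mono) auto
      then show ?thesis by (simp add: u mult_ac)
    qed
    also have "\<dots> = real n ^ t * (k t * a ^ t + \<kappa>)" using N by (simp add: k_def distrib_left)
    finally have "real n ^ t * ((\<tau> - \<delta>) * a ^ t) \<le> real n ^ t * (k t * a ^ t + \<kappa>)"
      using lower by (simp add: power_mult_distrib mult_ac)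
    then have "(\<tau> - \<delta>) * a ^ t \<le> k t * a ^ t + \<kappa>" using N by (simp add: mult_le_cancel_left)
    also have "\<kappa> \<le> \<delta>1 / 2 * a ^ t"
      using power_mono[OF ac, of t] c \<delta>1(1) by (simp add: \<kappa>_def)
    finally have "(\<tau> - \<delta>) * a ^ t \<le> (k t + \<delta>1 / 2) * a ^ t" by (simp add: distrib_right)
    then have "\<tau> - \<delta> \<le> k t + \<delta>1 / 2" using a0 by simp
    then have kt: "k t \<ge> \<tau> - \<delta>1" using \<delta>_le(1) by linarith
    have "\<forall>s\<le>r. \<bar>k s - turan_density r s\<bar> \<le> \<epsilon>"
    proof (rule \<delta>1(2)[of k, OF _ _ kt])
      show "moon_moser_sequence r k"
        using moon_moser_sequence_clique_weight[OF G(1), of "\<lambda>_. 1" r] n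
        by (simp add: clique_weight_one k_def[abs_def] cV[symmetric])
      have "k (Suc r) \<le> \<delta>" unfolding k_def using few N by (simp add: pos_divide_le_eq)
      then show "k (Suc r) \<le> \<delta>1" using \<delta>_le(1) \<delta>1(1) by linarith
    qed
    then show ?thesis by (simp add: k_def)
  qed
  then show ?thesis using \<delta> unfolding \<tau>_def by blast
qed

text \<open>At the Turan values \<open>dr = \<tau>\<close>, \<open>ds = R^2 * \<tau>\<close>,
  \<open>dn = 0\<close> the left side vanishes; this is its linear perturbation. Both denominators
  stay above \<open>\<tau> / 2\<close>.\<close>

lemma partition_error_bound:
  fixes \<tau> \<epsilon> R :: real
  assumes \<tau>: "\<tau> > 0" and \<epsilon>: "0 < \<epsilon>" "\<epsilon> \<le> \<tau> / 2" and R: "R \<ge> 1"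
    and d: "\<bar>dr - \<tau>\<bar> \<le> \<epsilon>" "\<bar>ds - R\<^sup>2 * \<tau>\<bar> \<le> \<epsilon>" "0 \<le> dn" "dn \<le> \<epsilon>"
  shows "1 - R\<^sup>2 * dr / ds + (2 * R\<^sup>2 + R) * dn / dr \<le> (3 * R\<^sup>2 + R + 1) * \<epsilon> * (2 / \<tau>)"
proof -
  have R2: "R\<^sup>2 \<ge> 1" using R by (simp add: one_le_power)
  have "\<tau> \<le> R\<^sup>2 * \<tau>" using R2 \<tau> by simp
  then have pos: "\<tau> / 2 \<le> dr" "\<tau> / 2 \<le> ds" using d \<epsilon> by linarith+
  have inv: "1 / dr \<le> 2 / \<tau>" "1 / ds \<le> 2 / \<tau>"
    using pos \<tau> by (simp_all add: field_simps)
  have "R\<^sup>2 * (\<tau> - dr) \<le> R\<^sup>2 * \<epsilon>" using d(1) by (intro mult_left_mono) auto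
  then have num: "ds - R\<^sup>2 * dr \<le> (1 + R\<^sup>2) * \<epsilon>" using d(2) by (simp add: algebra_simps)
  have "1 - R\<^sup>2 * dr / ds = (ds - R\<^sup>2 * dr) * (1 / ds)"
    using pos \<tau> by (simp add: field_simps)
  also have "\<dots> \<le> ((1 + R\<^sup>2) * \<epsilon>) * (1 / ds)"
    using num pos \<tau> by (intro mult_right_mono) auto
  also have "\<dots> \<le> ((1 + R\<^sup>2) * \<epsilon>) * (2 / \<tau>)"
    using inv R2 \<epsilon> by (intro mult_left_mono) auto
  finally have 1: "1 - R\<^sup>2 * dr / ds \<le> (1 + R\<^sup>2) * \<epsilon> * (2 / \<tau>)" .
  have "(2 * R\<^sup>2 + R) * dn / dr = ((2 * R\<^sup>2 + R) * dn) * (1 / dr)" by simp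
  also have "\<dots> \<le> ((2 * R\<^sup>2 + R) * \<epsilon>) * (2 / \<tau>)"
    using inv d R pos \<tau> \<epsilon> by (intro mult_mono) auto
  finally have 2: "(2 * R\<^sup>2 + R) * dn / dr \<le> (2 * R\<^sup>2 + R) * \<epsilon> * (2 / \<tau>)" .
  have "(1 + R\<^sup>2) * \<epsilon> * (2 / \<tau>) + (2 * R\<^sup>2 + R) * \<epsilon> * (2 / \<tau>) = (3 * R\<^sup>2 + R + 1) * \<epsilon> * (2 / \<tau>)"
    unfolding distrib_right[symmetric] by simp
  then show ?thesis using 1 2 by linarith
qed

lemma near_turan_from_clique_density:
  assumes r: "r \<ge> 2" and "\<epsilon> > 0"
  shows "\<exists>\<eta>>0. \<exists>n0. \<forall>n\<ge>n0. \<forall>G :: 'b graph. simple_graph G \<and> card (verts G) = n \<and>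
      real (card (cliques (Suc r) G)) \<le> \<eta> * real n ^ Suc r \<and>
      (\<forall>s\<le>r. \<bar>real (card (cliques s G)) / real n ^ s - turan_density r s\<bar> \<le> \<eta>) \<longrightarrow>
    (\<exists>T. is_turan_graph r n T \<and> verts T = verts G \<and>
      real (card ((edges G - edges T) \<union> (edges T - edges G))) \<le> \<epsilon> * real n ^ 2)"
proof -
  \<comment> \<open>With \<open>\<gamma> = x^2 / 2\<close> the square root term becomes
    \<open>r * x\<close>, and \<open>3 * \<gamma> \<le> 2 * x\<close> since
    \<open>x \<le> 1\<close>; the choice makes \<open>(r + 2) * x\<close> at most
    \<open>\<epsilon> / 2\<close>.\<close>
  define x where "x = min 1 (\<epsilon> / (2 * (real r + 2)))"
  have x: "0 < x" "x \<le> 1" using \<open>\<epsilon> > 0\<close> by (simp_all add: x_def add_nonneg_pos)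
  have "x * (real r + 2) \<le> \<epsilon> / (2 * (real r + 2)) * (real r + 2)"
    by (intro mult_right_mono) (simp_all add: x_def)
  also have "\<dots> = \<epsilon> / 2" by (simp add: field_simps)
  finally have x3: "x * (real r + 2) \<le> \<epsilon> / 2" .
  define \<gamma> where "\<gamma> = x\<^sup>2 / 2"
  have \<gamma>: "\<gamma> > 0" using x by (simp add: \<gamma>_def)
  have "sqrt (2 * \<gamma>) = x" using x by (simp add: \<gamma>_def)
  moreover have "3 * \<gamma> \<le> 2 * x" using mult_left_mono[OF x(2), of x] x(1) by (simp add: \<gamma>_def power2_eq_square)
  ultimately have \<gamma>\<epsilon>: "3 * \<gamma> + real r * sqrt (2 * \<gamma>) \<le> \<epsilon> / 2" using x3 by (simp add: algebra_simps)
  define \<tau> where "\<tau> = turan_density r r"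
  have \<tau>: "\<tau> > 0" using r by (auto simp: \<tau>_def intro: turan_density_pos)
  obtain s where s: "r = Suc s" using r by (cases r) auto
  have \<tau>s: "turan_density r s = (real r)\<^sup>2 * \<tau>"
    using turan_density_Suc[of r s] s by (simp add: \<tau>_def power2_eq_square)
  have \<tau>2: "2 * turan_density r 2 = 1 - 1 / real r"
    using turan_density_Suc[of r "Suc 0"] r by (simp add: numeral_2_eq_2 turan_density_1 field_simps)
  \<comment> \<open>The constant of \<open>partition_error_bound\<close>, doubled for
    \<open>clique_partition\<close>.\<close>
  define B where "B = 2 * (3 * (real r)\<^sup>2 + real r + 1) * (2 / \<tau>)"
  have B: "B > 0" using \<tau> r by (simp add: B_def add_pos_nonneg)
  define \<eta> where "\<eta> = Min {\<tau> / 2, \<gamma> / 2, \<gamma> / B}"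
  have \<eta>: "\<eta> > 0" using \<tau> \<gamma> B by (simp add: \<eta>_def)
  have \<eta>_le: "\<eta> \<le> \<tau> / 2" "\<eta> \<le> \<gamma> / 2" "\<eta> \<le> \<gamma> / B"
    unfolding \<eta>_def by (intro Min_le; simp)+
  \<comment> \<open>Makes the linear term \<open>r * n\<close> at most
    \<open>\<epsilon> / 2 * n^2\<close>.\<close>
  define n0 where "n0 = Suc (nat \<lceil>2 * real r / \<epsilon>\<rceil>)"
  have "\<exists>T. is_turan_graph r n T \<and> verts T = verts G \<and>
      real (card ((edges G - edges T) \<union> (edges T - edges G))) \<le> \<epsilon> * real n ^ 2"
    if n: "n \<ge> n0" and G: "simple_graph G" "card (verts G) = n"
      and few: "real (card (cliques (Suc r) G)) \<le> \<eta> * real n ^ Suc r"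
      and dens: "\<forall>s\<le>r. \<bar>real (card (cliques s G)) / real n ^ s - turan_density r s\<bar> \<le> \<eta>" for n and G :: "'b graph"
  proof -
    have N: "real n > 0" using n by (simp add: n0_def)
    have "2 * real r / \<epsilon> \<le> real n" using n unfolding n0_def by linarith
    then have nr: "real r \<le> \<epsilon> / 2 * real n" using \<open>\<epsilon> > 0\<close> by (simp add: field_simps)
    define k where "k s = real (card (cliques s G))" for s
    define d where "d s = k s / real n ^ s" for s
    have kd: "k s = d s * real n ^ s" for s using N by (simp add: d_def)
    have dd: "\<bar>d s - turan_density r s\<bar> \<le> \<eta>" if "s \<le> r" for s using dens that by (simp add: d_def k_def)
    have dr: "\<bar>d r - \<tau>\<bar> \<le> \<eta>" "\<bar>d s - (real r)\<^sup>2 * \<tau>\<bar> \<le> \<eta>"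
      using dd[of r] dd[of s] unfolding \<tau>s by (simp_all add: \<tau>_def s)
    have dn: "0 \<le> d (Suc r)" "d (Suc r) \<le> \<eta>"
      unfolding d_def k_def using few N by (simp_all add: pos_divide_le_eq)
    have "d r > 0" using dr(1) \<eta>_le(1) \<tau> by linarith
    then have kr: "k r > 0" using N by (simp add: kd)
    obtain K where K: "K \<in> cliques r G" and Kb:
      "real n * (real n - real (card (\<Union>x\<in>K. common_nbrs G (K - {x})))) +
      (\<Sum>x\<in>K. \<Sum>u\<in>common_nbrs G (K - {x}). real (card (common_nbrs G (insert u (K - {x})))))
      \<le> real n ^ 2 - real n * real r ^ 2 * k r / k s + real n * (2 * real r ^ 2 + real r) * k (Suc r) / k r"
      using exists_good_clique[OF G(1) G(2)[symmetric] s k_def kr] by blast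
    have ratios: "k r / k s = real n * (d r / d s)" "k (Suc r) / k r = real n * (d (Suc r) / d r)"
      using N by (simp_all add: kd s)
    have "real n ^ 2 - real n * real r ^ 2 * k r / k s + real n * (2 * real r ^ 2 + real r) * k (Suc r) / k r
      = real n ^ 2 - real n * real r ^ 2 * (real n * (d r / d s)) + real n * (2 * real r ^ 2 + real r) * (real n * (d (Suc r) / d r))"
      unfolding ratios[symmetric] by simp
    also have "\<dots> = real n ^ 2 * (1 - real r ^ 2 * d r / d s + (2 * real r ^ 2 + real r) * d (Suc r) / d r)"
      by (simp add: power2_eq_square right_diff_distrib distrib_left add_divide_distrib mult_ac)
    also have "\<dots> \<le> real n ^ 2 * ((3 * (real r)\<^sup>2 + real r + 1) * \<eta> * (2 / \<tau>))"
      using partition_error_bound[OF \<tau> \<eta> \<eta>_le(1) _ dr dn] r by (intro mult_left_mono) auto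
    finally have "2 * (real n * (real n - real (card (\<Union>x\<in>K. common_nbrs G (K - {x})))) +
      (\<Sum>x\<in>K. \<Sum>u\<in>common_nbrs G (K - {x}). real (card (common_nbrs G (insert u (K - {x}))))))
      \<le> 2 * (real n ^ 2 * ((3 * (real r)\<^sup>2 + real r + 1) * \<eta> * (2 / \<tau>)))"
      by (intro mult_left_mono order_trans[OF Kb]) auto
    also have "\<dots> = B * \<eta> * real n ^ 2" by (simp add: B_def)
    also have "\<dots> \<le> \<gamma> * real n ^ 2"
      using \<eta>_le(3) B by (intro mult_right_mono) (auto simp: field_simps)
    finally obtain p :: "'b \<Rightarrow> nat" where p: "\<forall>v. p v < r"
      "real (card {(u, v) \<in> verts G \<times> verts G. {u, v} \<in> edges G \<and> p u = p v}) \<le> \<gamma> * real n ^ 2"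
      using clique_partition[OF G(1) G(2)[symmetric] K] r by (meson order_trans zero_less_numeral less_le_trans)
    have "1 - 1 / real r - \<gamma> \<le> 2 * d 2" using dd[of 2] r \<eta>_le(2) \<tau>2 by linarith
    then have "(1 - 1 / real r - \<gamma>) * real n ^ 2 \<le> 2 * d 2 * real n ^ 2" by (intro mult_right_mono) auto
    then have "(1 - 1 / real r - \<gamma>) * real n ^ 2 \<le> real (card {(u, v) \<in> verts G \<times> verts G. {u, v} \<in> edges G})"
      unfolding card_adjacent_pairs[OF G(1)] by (simp add: kd flip: k_def)
    from near_turan_graph[OF G(1) _ _ G(2)[symmetric] p(2) this] p(1) r
    obtain T where T: "is_turan_graph r n T" "verts T = verts G"
      "real (card ((edges G - edges T) \<union> (edges T - edges G))) \<le> (3 * \<gamma> + real r * sqrt (2 * \<gamma>)) * real n ^ 2 + real r * real n"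
      by auto
    have "(3 * \<gamma> + real r * sqrt (2 * \<gamma>)) * real n ^ 2 + real r * real n \<le> \<epsilon> / 2 * real n ^ 2 + (\<epsilon> / 2 * real n) * real n"
      using \<gamma>\<epsilon> nr by (intro add_mono mult_right_mono) auto
    also have "\<dots> = \<epsilon> * real n ^ 2" by (simp add: power2_eq_square)
    finally show ?thesis using T by (meson order_trans)
  qed
  then show ?thesis using \<eta> by blast
qed

theorem theorem1p4:
  fixes t r :: nat and H :: "'a graph"
  assumes "t \<ge> 2"
    and "simple_graph H"
    and "chromatic_number H = r + 1"
    and "r + 1 > t"
  shows "\<forall>\<epsilon>::real. \<epsilon> > 0 \<longrightarrow>
    (\<exists>\<delta>::real. \<delta> > 0 \<and> (\<exists>n0::nat. \<forall>n\<ge>n0. \<forall>G :: nat graph.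
       simple_graph G \<and> verts G = {1..n} \<and> H_free H G \<and>
       clique_spectral_radius t G \<ge>
         (real ((r - 1) choose (t - 1)) * (1 / real r) ^ (t - 1) - \<delta>) * real n ^ (t - 1)
       \<longrightarrow> (\<exists>T. is_turan_graph r n T \<and> verts T = verts G \<and>
             real (card ((edges G - edges T) \<union> (edges T - edges G))) \<le> \<epsilon> * real n ^ 2)))"
proof (intro allI impI)
  fix \<epsilon> :: real assume "\<epsilon> > 0"
  have t: "2 \<le> t" "t \<le> r" using assms by auto
  then have "2 \<le> r" by simp
  from near_turan_from_clique_density[OF this \<open>\<epsilon> > 0\<close>] obtain \<eta> n1 where \<eta>: "\<eta> > 0"
    and near: "\<And>n (G :: nat graph). n \<ge> n1 \<Longrightarrow> simple_graph G \<Longrightarrow> card (verts G) = n \<Longrightarrow>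
      real (card (cliques (Suc r) G)) \<le> \<eta> * real n ^ Suc r \<Longrightarrow>
      \<forall>s\<le>r. \<bar>real (card (cliques s G)) / real n ^ s - turan_density r s\<bar> \<le> \<eta> \<Longrightarrow>
      \<exists>T. is_turan_graph r n T \<and> verts T = verts G \<and>
        real (card ((edges G - edges T) \<union> (edges T - edges G))) \<le> \<epsilon> * real n ^ 2"
    by blast
  from clique_density_from_spectral_radius[OF t \<eta>] obtain \<delta> where \<delta>: "\<delta> > 0"
    and dens: "\<And>n G. n > 0 \<Longrightarrow> simple_graph G \<Longrightarrow> verts G = {1..n} \<Longrightarrow>
      real (card (cliques (Suc r) G)) \<le> \<delta> * real n ^ Suc r \<Longrightarrow>
      clique_spectral_radius t G \<ge> (real t * turan_density r t - \<delta>) * real n ^ (t - 1) \<Longrightarrow>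
      \<forall>s\<le>r. \<bar>real (card (cliques s G)) / real n ^ s - turan_density r s\<bar> \<le> \<eta>"
    by blast
  \<comment> \<open>The minimum serves both the spectral step, which needs \<open>\<delta>\<close>,
    and the partition step, which needs \<open>\<eta>\<close>.\<close>
  obtain n2 where few: "\<And>G :: nat graph. simple_graph G \<Longrightarrow> card (verts G) \<ge> n2 \<Longrightarrow> H_free H G \<Longrightarrow>
      real (card (cliques (Suc r) G)) \<le> min \<delta> \<eta> * real (card (verts G)) ^ Suc r"
    using H_free_few_cliques[OF assms(2), of "min \<delta> \<eta>"] \<delta> \<eta> assms(3) by auto
  show "\<exists>\<delta>::real. \<delta> > 0 \<and> (\<exists>n0::nat. \<forall>n\<ge>n0. \<forall>G :: nat graph.
       simple_graph G \<and> verts G = {1..n} \<and> H_free H G \<and>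
       clique_spectral_radius t G \<ge>
         (real ((r - 1) choose (t - 1)) * (1 / real r) ^ (t - 1) - \<delta>) * real n ^ (t - 1)
       \<longrightarrow> (\<exists>T. is_turan_graph r n T \<and> verts T = verts G \<and>
             real (card ((edges G - edges T) \<union> (edges T - edges G))) \<le> \<epsilon> * real n ^ 2))"
    unfolding turan_density_spectral[OF t]
  proof (intro exI[of _ \<delta>] conjI \<delta> exI[of _ "max (Suc n1) n2"] allI impI)
    fix n :: nat and G :: "nat graph"
    assume n: "max (Suc n1) n2 \<le> n"
      and asm: "simple_graph G \<and> verts G = {1..n} \<and> H_free H G \<and>
        (real t * turan_density r t - \<delta>) * real n ^ (t - 1) \<le> clique_spectral_radius t G"
    then have G: "simple_graph G" "verts G = {1..n}" "card (verts G) = n" "H_free H G" by auto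
    have card_le: "real (card (cliques (Suc r) G)) \<le> min \<delta> \<eta> * real n ^ Suc r"
      using few[OF G(1) _ G(4)] G(3) n by simp
    have "min \<delta> \<eta> * real n ^ Suc r \<le> \<delta> * real n ^ Suc r" "min \<delta> \<eta> * real n ^ Suc r \<le> \<eta> * real n ^ Suc r"
      by (intro mult_right_mono; simp)+
    then have few': "real (card (cliques (Suc r) G)) \<le> \<delta> * real n ^ Suc r"
      "real (card (cliques (Suc r) G)) \<le> \<eta> * real n ^ Suc r" using card_le by linarith+
    have "n1 \<le> n" "n > 0" using n by auto
    show "\<exists>T. is_turan_graph r n T \<and> verts T = verts G \<and>
        real (card ((edges G - edges T) \<union> (edges T - edges G))) \<le> \<epsilon> * real n ^ 2"
      using asm by (intro near[OF \<open>n1 \<le> n\<close> G(1,3) few'(2)] dens[OF \<open>n > 0\<close> G(1,2) few'(1)]) blast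
  qed
qed

end
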